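(* Let $G$ be a finitely generated nilpotent group (of any nilpotency class), and let $H$ be a subgroup of $G$. Then $$\mathrm{dom}_G^{\mathcal{N}il}(H) = H,$$ where $\mathcal{N}il$ is the category of all nilpotent groups.
   Context: $\mathcal{N}il$ denotes the full subcategory of the category of groups whose objects are all nilpotent groups (of arbitrary finite class). For a full subcategory $\mathcal{C}$ of the category of groups that is closed under passing to subgroups, a group $G \in \mathcal{C}$ and a subgroup $H$ of $G$, the dominion of $H$ in $G$ (in the category $\mathcal{C}$) is the subgroup $$\mathrm{dom}_G^{\mathcal{C}}(H) = \{ g \in G \mid \text{for all } K \in \mathcal{C} \text{ and all group homomorphisms } f_1,f_2\colon G \to K, \text{ if } f_1|_H = f_2|_H \text{ then } f_1(g) = f_2(g)\}.$$ *)

theory Defs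
  imports "HOL-Algebra.Generated_Groups"
begin

text \<open>
  \<open>commutator_subgroup G A B\<close> is $[A,B]$, generated by all $aba^{-1}b^{-1}$ with
  $a \in A$, $b \in B$.  The library's \<open>derived G A\<close> is the case \<open>A = B\<close>.
\<close>

definition commutator_subgroup ::
  "('a, 'b) monoid_scheme \<Rightarrow> 'a set \<Rightarrow> 'a set \<Rightarrow> 'a set" where
  "commutator_subgroup G A B =
     generate G (\<Union>a \<in> A. \<Union>b \<in> B. {a \<otimes>\<^bsub>G\<^esub> b \<otimes>\<^bsub>G\<^esub> inv\<^bsub>G\<^esub> a \<otimes>\<^bsub>G\<^esub> inv\<^bsub>G\<^esub> b})"

text \<open>Indexing starts at 0: \<open>lower_central G n\<close> is $\gamma_{n+1}(G)$.\<close>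

primrec lower_central :: "('a, 'b) monoid_scheme \<Rightarrow> nat \<Rightarrow> 'a set" where
  "lower_central G 0 = carrier G"
| "lower_central G (Suc n) = commutator_subgroup G (lower_central G n) (carrier G)"

definition nilpotent_group :: "('a, 'b) monoid_scheme \<Rightarrow> bool" where
  "nilpotent_group G \<longleftrightarrow> group G \<and> (\<exists>c. lower_central G c = {\<one>\<^bsub>G\<^esub>})"

definition finitely_generated_group :: "('a, 'b) monoid_scheme \<Rightarrow> bool" where
  "finitely_generated_group G \<longleftrightarrow>
     group G \<and> (\<exists>S. finite S \<and> S \<subseteq> carrier G \<and> generate G S = carrier G)"

text \<open>
  The full subcategory is given by the predicate \<open>C\<close> selecting its objects among the groups
  with elements in a type \<open>'k\<close>.
\<close>

definition dominion ::
  "('k monoid \<Rightarrow> bool) \<Rightarrow> ('a, 'b) monoid_scheme \<Rightarrow> 'a set \<Rightarrow> 'a set" where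
  "dominion C G H = {g \<in> carrier G. \<forall>K f1 f2.
      C K \<longrightarrow> f1 \<in> hom G K \<longrightarrow> f2 \<in> hom G K \<longrightarrow>
      (\<forall>h \<in> H. f1 h = f2 h) \<longrightarrow> f1 g = f2 g}"

text \<open>
  A definition cannot quantify over all types, so the test groups \<open>K\<close> live on the type
  \<open>'a list\<close>.  This loses nothing: two homomorphisms from \<open>G\<close> only see the subgroup generated by
  their images, and that subgroup has an isomorphic copy on \<open>'a list\<close>.  The lemmas
  \<open>nil_dominion_any_universe\<close> and \<open>nil_dominion_subset_dominion\<close> below establish this for test
  groups over an arbitrary type.
\<close>

definition nil_dominion :: "('a, 'b) monoid_scheme \<Rightarrow> 'a set \<Rightarrow> 'a set" where
  "nil_dominion G H = dominion (nilpotent_group :: 'a list monoid \<Rightarrow> bool) G H"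


lemma lower_central_in_carrier:
  assumes "group G"
  shows "lower_central G n \<subseteq> carrier G"
proof (induction n)
  case (Suc n)
  interpret group G by fact
  show ?case
    unfolding lower_central.simps commutator_subgroup_def
    by (rule generate_incl) (use Suc in blast)
qed simp

lemma one_in_lower_central:
  assumes "group G"
  shows "\<one>\<^bsub>G\<^esub> \<in> lower_central G n"
proof (cases n)
  case 0
  interpret group G by fact
  show ?thesis by (simp add: 0)
next
  case (Suc m)
  show ?thesis by (simp add: Suc commutator_subgroup_def generate.one)
qed

lemma hom_lower_central:
  assumes "group M" "group K" "f \<in> hom M K"
  shows "f ` lower_central M n \<subseteq> lower_central K n"
proof (induction n)
  case 0
  show ?case using assms(3) by (auto simp: hom_def)
next
  case (Suc n)
  interpret group_hom M K f
    using assms by (simp add: group_hom_def group_hom_axioms_def)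
  let ?X = "\<Union>a \<in> lower_central M n. \<Union>b \<in> carrier M.
    {a \<otimes>\<^bsub>M\<^esub> b \<otimes>\<^bsub>M\<^esub> inv\<^bsub>M\<^esub> a \<otimes>\<^bsub>M\<^esub> inv\<^bsub>M\<^esub> b}"
  let ?Y = "\<Union>a \<in> lower_central K n. \<Union>b \<in> carrier K.
    {a \<otimes>\<^bsub>K\<^esub> b \<otimes>\<^bsub>K\<^esub> inv\<^bsub>K\<^esub> a \<otimes>\<^bsub>K\<^esub> inv\<^bsub>K\<^esub> b}"
  have lc: "lower_central M n \<subseteq> carrier M"
    by (rule lower_central_in_carrier) fact
  have X: "?X \<subseteq> carrier M" using lc by blast
  have XY: "f ` ?X \<subseteq> ?Y"
  proof
    fix y assume "y \<in> f ` ?X"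
    then obtain a b where a: "a \<in> lower_central M n" and b: "b \<in> carrier M"
      and y: "y = f (a \<otimes>\<^bsub>M\<^esub> b \<otimes>\<^bsub>M\<^esub> inv\<^bsub>M\<^esub> a \<otimes>\<^bsub>M\<^esub> inv\<^bsub>M\<^esub> b)"
      by blast
    have "a \<in> carrier M" using a lc by blast
    then have "y = f a \<otimes>\<^bsub>K\<^esub> f b \<otimes>\<^bsub>K\<^esub> inv\<^bsub>K\<^esub> f a \<otimes>\<^bsub>K\<^esub> inv\<^bsub>K\<^esub> f b"
      using b y by simp
    moreover have "f a \<in> lower_central K n" "f b \<in> carrier K"
      using a b Suc by auto
    ultimately show "y \<in> ?Y" by blast
  qed
  have "f ` generate M ?X = generate K (f ` ?X)"
    using generate_img[OF X] by simp
  also have "\<dots> \<subseteq> generate K ?Y"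
    by (rule H.mono_generate[OF XY])
  finally show ?case
    by (simp add: commutator_subgroup_def)
qed

lemma nilpotent_group_inj_hom:
  assumes "group M" "nilpotent_group K" "f \<in> hom M K" "inj_on f (carrier M)"
  shows "nilpotent_group M"
proof -
  have K: "group K" using assms(2) by (simp add: nilpotent_group_def)
  interpret group_hom M K f
    using assms K by (simp add: group_hom_def group_hom_axioms_def)
  obtain c where c: "lower_central K c = {\<one>\<^bsub>K\<^esub>}"
    using assms(2) by (auto simp: nilpotent_group_def)
  have "x = \<one>\<^bsub>M\<^esub>" if "x \<in> lower_central M c" for x
  proof -
    have "f x = f \<one>\<^bsub>M\<^esub>" using hom_lower_central[OF assms(1) K assms(3), of c] c that by auto
    then show ?thesis
      using assms(4) lower_central_in_carrier[OF assms(1), of c] that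
      by (metis G.one_closed inj_onD subsetD)
  qed
  then have "lower_central M c = {\<one>\<^bsub>M\<^esub>}"
    using one_in_lower_central[OF assms(1), of c] by blast
  then show ?thesis using assms(1) by (auto simp: nilpotent_group_def)
qed

text \<open>
  Every element of the subgroup generated by the images of \<open>f1\<close> and \<open>f2\<close> is an alternating
  product, since units may be used as padding.
\<close>

primrec alt_word ::
  "('k, 'c) monoid_scheme \<Rightarrow> ('a \<Rightarrow> 'k) \<Rightarrow> ('a \<Rightarrow> 'k) \<Rightarrow> bool \<Rightarrow> 'a list \<Rightarrow> 'k" where
  "alt_word K f1 f2 s [] = \<one>\<^bsub>K\<^esub>"
| "alt_word K f1 f2 s (x # xs) =
     (if s then f1 x else f2 x) \<otimes>\<^bsub>K\<^esub> alt_word K f1 f2 (\<not> s) xs"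

lemma generate_subset_alt_word:
  assumes G: "group G" and K: "group K" and f1: "f1 \<in> hom G K" and f2: "f2 \<in> hom G K"
  shows "generate K (f1 ` carrier G \<union> f2 ` carrier G)
           \<subseteq> alt_word K f1 f2 True ` lists (carrier G)"
proof
  interpret F1: group_hom G K f1
    using assms by (simp add: group_hom_def group_hom_axioms_def)
  interpret F2: group_hom G K f2
    using assms by (simp add: group_hom_def group_hom_axioms_def)
  let ?S = "f1 ` carrier G \<union> f2 ` carrier G"
  let ?W = "alt_word K f1 f2 True ` lists (carrier G)"
  have wc: "alt_word K f1 f2 s xs \<in> carrier K" if "xs \<in> lists (carrier G)" for s xs
    using that by (induction xs arbitrary: s) auto
  have S: "?S \<subseteq> carrier K" by auto
  have m1: "f1 a \<otimes>\<^bsub>K\<^esub> w \<in> ?W" if a: "a \<in> carrier G" and w: "w \<in> ?W" for a w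
  proof -
    obtain xs where xs: "xs \<in> lists (carrier G)" "w = alt_word K f1 f2 True xs"
      using w by blast
    have "f1 a \<otimes>\<^bsub>K\<^esub> w = alt_word K f1 f2 True (a # \<one>\<^bsub>G\<^esub> # xs)"
      using a xs wc by simp
    moreover have "a # \<one>\<^bsub>G\<^esub> # xs \<in> lists (carrier G)" using a xs by simp
    ultimately show ?thesis by blast
  qed
  have m2: "f2 a \<otimes>\<^bsub>K\<^esub> w \<in> ?W" if a: "a \<in> carrier G" and w: "w \<in> ?W" for a w
  proof -
    obtain xs where xs: "xs \<in> lists (carrier G)" "w = alt_word K f1 f2 True xs"
      using w by blast
    have "f2 a \<otimes>\<^bsub>K\<^esub> w = alt_word K f1 f2 True (\<one>\<^bsub>G\<^esub> # a # xs)"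
      using a xs wc by simp
    moreover have "\<one>\<^bsub>G\<^esub> # a # xs \<in> lists (carrier G)" using a xs by simp
    ultimately show ?thesis by blast
  qed
  have Wc: "w \<in> carrier K" if "w \<in> ?W" for w using that wc by blast
  fix x assume x: "x \<in> generate K ?S"
  then have "x \<in> carrier K \<and> (\<forall>w \<in> ?W. x \<otimes>\<^bsub>K\<^esub> w \<in> ?W)"
  proof (induction rule: generate.induct)
    case one
    show ?case using Wc by simp
  next
    case (incl h)
    then consider a where "a \<in> carrier G" "h = f1 a" | a where "a \<in> carrier G" "h = f2 a"
      by blast
    then show ?case by cases (simp_all add: m1 m2 del: in_lists_conv_set)
  next
    case (inv h)
    then consider a where "a \<in> carrier G" "h = f1 a" | a where "a \<in> carrier G" "h = f2 a"
      by blast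
    then show ?case
    proof cases
      case 1
      then show ?thesis
        by (simp add: m1 flip: F1.hom_inv del: image_iff)
    next
      case 2
      then show ?thesis
        by (simp add: m2 flip: F2.hom_inv del: image_iff)
    qed
  next
    case (eng h1 h2)
    have "h1 \<otimes>\<^bsub>K\<^esub> h2 \<otimes>\<^bsub>K\<^esub> w \<in> ?W" if w: "w \<in> ?W" for w
    proof -
      have "h1 \<otimes>\<^bsub>K\<^esub> h2 \<otimes>\<^bsub>K\<^esub> w = h1 \<otimes>\<^bsub>K\<^esub> (h2 \<otimes>\<^bsub>K\<^esub> w)"
        using eng.IH Wc[OF w] by (intro F1.H.m_assoc) auto
      moreover have "h2 \<otimes>\<^bsub>K\<^esub> w \<in> ?W" using eng.IH(2) w by blast
      ultimately show ?thesis using eng.IH(1) by metis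
    qed
    then show ?case using eng.IH by blast
  qed
  moreover have "\<one>\<^bsub>K\<^esub> \<in> ?W" by (rule image_eqI[of _ _ "[]"]) auto
  ultimately have "x \<otimes>\<^bsub>K\<^esub> \<one>\<^bsub>K\<^esub> \<in> ?W" "x \<in> carrier K" by blast+
  then show "x \<in> ?W" by simp
qed

lemma nil_dominion_any_universe:
  fixes G :: "('a, 'b) monoid_scheme" and K :: "('k, 'c) monoid_scheme"
  assumes G: "group G" and g: "g \<in> nil_dominion G H"
    and nK: "nilpotent_group K"
    and f1: "f1 \<in> hom G K" and f2: "f2 \<in> hom G K"
    and eq: "\<forall>h \<in> H. f1 h = f2 h"
  shows "f1 g = f2 g"
proof -
  have K: "group K" using nK by (simp add: nilpotent_group_def)
  interpret F1: group_hom G K f1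
    using G K f1 by (simp add: group_hom_def group_hom_axioms_def)
  interpret F2: group_hom G K f2
    using G K f2 by (simp add: group_hom_def group_hom_axioms_def)
  define L where "L = generate K (f1 ` carrier G \<union> f2 ` carrier G)"
  have "f1 ` carrier G \<union> f2 ` carrier G \<subseteq> carrier K" by auto
  then have sL: "subgroup L K" unfolding L_def by (rule F1.H.generate_is_subgroup)
  interpret L: subgroup L K by (fact sL)
  define p :: "'a list \<Rightarrow> 'k" where "p = alt_word K f1 f2 True"
  define q where "q = inv_into (lists (carrier G)) p"
  have pq: "p (q x) = x" if "x \<in> L" for x
    using generate_subset_alt_word[OF G K f1 f2] that
    unfolding q_def p_def L_def by (intro f_inv_into_f) blast
  define M :: "'a list monoid" where
    "M = \<lparr>carrier = q ` L, mult = (\<lambda>x y. q (p x \<otimes>\<^bsub>K\<^esub> p y)), one = q \<one>\<^bsub>K\<^esub>\<rparr>"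
  have gM: "group M"
  proof (rule groupI)
    fix x assume "x \<in> carrier M"
    then obtain u where u: "u \<in> L" "x = q u" by (auto simp: M_def)
    then have "q (inv\<^bsub>K\<^esub> u) \<in> carrier M" "q (inv\<^bsub>K\<^esub> u) \<otimes>\<^bsub>M\<^esub> x = \<one>\<^bsub>M\<^esub>"
      by (auto simp: M_def pq)
    then show "\<exists>y\<in>carrier M. y \<otimes>\<^bsub>M\<^esub> x = \<one>\<^bsub>M\<^esub>" by blast
  qed (auto simp: M_def pq F1.H.m_assoc)
  have pM: "p \<in> hom M K" by (auto simp: hom_def M_def pq)
  have "inj_on p (carrier M)" by (auto simp: inj_on_def M_def pq)
  then have nM: "nilpotent_group M"
    using nilpotent_group_inj_hom[OF gM nK pM] by blast
  have inL: "f1 x \<in> L" "f2 x \<in> L" if "x \<in> carrier G" for x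
    using that unfolding L_def by (auto intro: generate.incl)
  have "q \<circ> f1 \<in> hom G M" "q \<circ> f2 \<in> hom G M"
    by (auto simp: hom_def M_def pq inL)
  moreover have "\<forall>h \<in> H. (q \<circ> f1) h = (q \<circ> f2) h" using eq by simp
  ultimately have "(q \<circ> f1) g = (q \<circ> f2) g"
    using g nM unfolding nil_dominion_def dominion_def by blast
  moreover have "g \<in> carrier G" using g by (simp add: nil_dominion_def dominion_def)
  ultimately have "p (q (f1 g)) = p (q (f2 g))" "f1 g \<in> L" "f2 g \<in> L"
    using inL by simp_all
  then show ?thesis by (simp only: pq)
qed

lemma nil_dominion_subset_dominion:
  assumes "group G"
  shows "nil_dominion G H \<subseteq> dominion (nilpotent_group :: 'k monoid \<Rightarrow> bool) G H"
proof
  fix g assume g: "g \<in> nil_dominion G H"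
  then have "g \<in> carrier G" by (simp add: nil_dominion_def dominion_def)
  then show "g \<in> dominion (nilpotent_group :: 'k monoid \<Rightarrow> bool) G H"
    unfolding dominion_def using nil_dominion_any_universe[OF assms g] by blast
qed

end

theory Submission
  imports Defs "HOL-Algebra.Multiplicative_Group" "HOL-Computational_Algebra.Primes"
begin

text \<open>
  Given \<open>g\<close> outside \<open>H\<close>, enlarge \<open>H\<close> to a subgroup \<open>M\<close> that is maximal among the subgroups omitting
  \<open>g\<close>, and let \<open>N\<close> be its normal core. Modulo \<open>N\<close> the centre meets \<open>M\<close> trivially, so by maximality
  all its nontrivial cyclic subgroups contain one common nontrivial element; hence the centre is a
  \<open>p\<close>-group for some prime \<open>p\<close>. Climbing the upper central series, finite generation makes every
  element of \<open>G\<close> a \<open>p\<close>-element modulo \<open>N\<close>. The factors of the lower central series are finitely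
  generated, so \<open>G / N\<close> is built from finitely many central steps of order \<open>p\<close>, and since
  $(x - 1)^p = x^p - 1$ in characteristic \<open>p\<close>, a power of the augmentation ideal annihilates all
  functions from \<open>G / N\<close> to the integers modulo \<open>p\<close>. In particular the indicator function of \<open>M\<close> is a
  polynomial function, and the polynomial functions of bounded degree form with \<open>G\<close> a nilpotent
  semidirect product. Its complement \<open>G\<close> and the conjugate of \<open>G\<close> by the indicator function
  give two homomorphisms that agree on \<open>M\<close> but not at \<open>g\<close>.
\<close>

section \<open>Commutators modulo a normal subgroup\<close>

context group
begin

definition commutator :: "'a \<Rightarrow> 'a \<Rightarrow> 'a" where
  "commutator a b = a \<otimes> b \<otimes> inv a \<otimes> inv b"

text \<open>For normal \<open>N\<close> this is the preimage in \<open>G\<close> of the centralizer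
  of the image of \<open>T\<close> in \<open>G Mod N\<close>; \<open>T = carrier G\<close> gives the
  preimage of the centre. Stating it by commutators keeps most of the work inside \<open>G\<close>,
  away from cosets.\<close>

definition centralizer_mod :: "'a set \<Rightarrow> 'a set \<Rightarrow> 'a set" where
  "centralizer_mod N T = {a \<in> carrier G. \<forall>t \<in> T. commutator a t \<in> N}"

lemma inv_mult_cancel_left:
  assumes "a \<in> carrier G" "b \<in> carrier G"
  shows "a \<otimes> (inv a \<otimes> b) = b" "inv a \<otimes> (a \<otimes> b) = b"
  using assms by (simp_all flip: m_assoc)

lemmas group_normalize = m_assoc inv_mult_group inv_mult_cancel_left

section \<open>Commutator identities\<close>

lemma commutator_closed [simp, intro]:
  "a \<in> carrier G \<Longrightarrow> b \<in> carrier G \<Longrightarrow> commutator a b \<in> carrier G"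
  by (simp add: commutator_def)

lemma commutator_mult_left:
  assumes "a \<in> carrier G" "b \<in> carrier G" "t \<in> carrier G"
  shows "commutator (a \<otimes> b) t = a \<otimes> commutator b t \<otimes> inv a \<otimes> commutator a t"
  using assms by (simp add: commutator_def group_normalize)

lemma commutator_inv_left:
  assumes "a \<in> carrier G" "t \<in> carrier G"
  shows "commutator (inv a) t = inv a \<otimes> inv (commutator a t) \<otimes> a"
  using assms by (simp add: commutator_def group_normalize)

lemma commutator_swap:
  assumes "a \<in> carrier G" "b \<in> carrier G"
  shows "commutator b a = inv (commutator a b)"
  using assms by (simp add: commutator_def group_normalize)

lemma conjugate_eq_commutator:
  assumes "a \<in> carrier G" "b \<in> carrier G"
  shows "b \<otimes> a \<otimes> inv b = inv (commutator a b) \<otimes> a"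
  using assms by (simp add: commutator_def group_normalize)

lemma mult_eq_commutator:
  assumes "a \<in> carrier G" "b \<in> carrier G"
  shows "a \<otimes> b = commutator a b \<otimes> (b \<otimes> a)"
    and "a \<otimes> b = b \<otimes> a \<otimes> commutator (inv a) (inv b)"
  using assms by (simp_all add: commutator_def group_normalize)

lemma generate_superset: "S \<subseteq> generate G S"
  by (auto intro: generate.incl)

section \<open>Centralizers modulo a normal subgroup\<close>

lemma centralizer_mod_subset: "centralizer_mod N T \<subseteq> carrier G"
  by (auto simp: centralizer_mod_def)

lemma commutator_normal:
  assumes "N \<lhd> G" "a \<in> N" "b \<in> carrier G"
  shows "commutator a b \<in> N" "commutator b a \<in> N"
proof -
  interpret N: normal N G by fact
  have "a \<otimes> (b \<otimes> inv a \<otimes> inv b) \<in> N"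
    using assms(2,3) N.inv_op_closed2 by blast
  then show "commutator a b \<in> N"
    using assms(2,3) by (simp add: commutator_def m_assoc)
  then show "commutator b a \<in> N"
    using assms(2,3) commutator_swap[of a b] by simp
qed

lemma subgroup_centralizer_mod:
  assumes "N \<lhd> G" "T \<subseteq> carrier G"
  shows "subgroup (centralizer_mod N T) G"
proof -
  interpret N: normal N G by fact
  have T: "t \<in> carrier G" if "t \<in> T" for t using that assms(2) by blast
  show ?thesis
  proof (rule subgroupI)
    have "\<one> \<in> centralizer_mod N T"
      using T commutator_normal(1)[OF assms(1)] by (simp add: centralizer_mod_def)
    then show "centralizer_mod N T \<noteq> {}" by blast
  next
    fix a b assume a: "a \<in> centralizer_mod N T"
    have "commutator (inv a) t \<in> N" if "t \<in> T" for t
      using a T[OF that] that N.inv_op_closed1[of a "inv (commutator a t)"]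
      by (simp add: centralizer_mod_def commutator_inv_left)
    then show "inv a \<in> centralizer_mod N T"
      using a by (simp add: centralizer_mod_def)
    assume b: "b \<in> centralizer_mod N T"
    have "commutator (a \<otimes> b) t \<in> N" if "t \<in> T" for t
      using a b T[OF that] that N.inv_op_closed2[of a "commutator b t"]
      by (simp add: centralizer_mod_def commutator_mult_left)
    then show "a \<otimes> b \<in> centralizer_mod N T"
      using a b by (simp add: centralizer_mod_def)
  qed (rule centralizer_mod_subset)
qed

lemma centralizer_mod_swap:
  assumes "N \<lhd> G" "S \<subseteq> carrier G" "T \<subseteq> centralizer_mod N S"
  shows "S \<subseteq> centralizer_mod N T"
proof
  interpret N: normal N G by fact
  fix s assume s: "s \<in> S"
  have "commutator s t \<in> N" if "t \<in> T" for t
  proof -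
    have "commutator t s \<in> N" "t \<in> carrier G" "s \<in> carrier G"
      using that s assms(2,3) by (auto simp: centralizer_mod_def)
    then show ?thesis using commutator_swap[of t s] by simp
  qed
  then show "s \<in> centralizer_mod N T"
    using s assms(2) by (auto simp: centralizer_mod_def)
qed

text \<open>\<open>centralizer_mod N T\<close> is a subgroup containing \<open>S\<close>, hence all
  of \<open>generate G S\<close>; commuting modulo \<open>N\<close> is symmetric, which turns the
  inclusion round. So centrality may be tested on generators.\<close>

lemma centralizer_mod_generate:
  assumes "N \<lhd> G" "S \<subseteq> carrier G" "T \<subseteq> centralizer_mod N S"
  shows "T \<subseteq> centralizer_mod N (generate G S)"
proof -
  have T: "T \<subseteq> carrier G" using assms(3) centralizer_mod_subset by blast
  have "generate G S \<subseteq> centralizer_mod N T"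
    using centralizer_mod_swap[OF assms] subgroup_centralizer_mod[OF assms(1) T]
    by (rule generate_subgroup_incl)
  then show ?thesis
    by (rule centralizer_mod_swap[OF assms(1) T])
qed

text \<open>Conjugation changes an element of \<open>L\<close> only by a commutator, which lies in
  \<open>N\<close> and hence in \<open>L\<close>.\<close>

lemma normal_between_centralizer:
  assumes "subgroup L G" "N \<subseteq> L" "L \<subseteq> centralizer_mod N (carrier G)"
  shows "L \<lhd> G"
proof -
  interpret L: subgroup L G by fact
  have "x \<otimes> h \<otimes> inv x \<in> L" if "x \<in> carrier G" "h \<in> L" for x h
  proof -
    have "commutator h x \<in> L" using that assms(2,3) by (auto simp: centralizer_mod_def)
    then show ?thesis using that by (simp add: conjugate_eq_commutator)
  qed
  then show ?thesis using assms(1) by (simp add: normal_inv_iff)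
qed

lemma subset_centralizer_mod:
  assumes "N \<lhd> G"
  shows "N \<subseteq> centralizer_mod N (carrier G)"
  using assms commutator_normal(1)[OF assms] normal_imp_subgroup[OF assms]
  by (auto simp: centralizer_mod_def dest: subgroup.mem_carrier)

lemma centralizer_mod_normal:
  assumes "N \<lhd> G"
  shows "centralizer_mod N (carrier G) \<lhd> G"
  using subgroup_centralizer_mod[OF assms, of "carrier G"] subset_centralizer_mod[OF assms]
  by (intro normal_between_centralizer[where N = N]) auto

section \<open>Passage to the quotient and commutators of powers\<close>

lemma group_hom_rcoset:
  assumes "N \<lhd> G"
  shows "group_hom G (G Mod N) (\<lambda>a. N #> a)"
  using assms normal.r_coset_hom_Mod[OF assms] normal.factorgroup_is_group[OF assms]
  by (simp add: group_hom_def group_hom_axioms_def is_group)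

lemma rcoset_eq_one_iff:
  assumes "N \<lhd> G" "a \<in> carrier G"
  shows "N #> a = \<one>\<^bsub>G Mod N\<^esub> \<longleftrightarrow> a \<in> N"
  using assms coset_join1 coset_join2 normal_imp_subgroup[OF assms(1)]
  by (metis one_FactGroup)

text \<open>In \<open>commutator_mult_left\<close> the conjugation by \<open>x\<close> fixes all
  powers of \<open>commutator x s\<close>, so each further factor \<open>x\<close> contributes one
  more commutator.\<close>

lemma commutator_pow_left:
  assumes x: "x \<in> carrier G" and s: "s \<in> carrier G"
    and c: "x \<otimes> commutator x s = commutator x s \<otimes> x"
  shows "commutator (x [^] (m::nat)) s = commutator x s [^] m"
proof (induction m)
  case 0
  then show ?case using s by (simp add: commutator_def)
next
  case (Suc m)
  let ?c = "commutator x s"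
  have "x \<otimes> ?c [^] m = ?c [^] m \<otimes> x"
  proof (induction m)
    case (Suc m)
    have "x \<otimes> ?c [^] Suc m = (x \<otimes> ?c [^] m) \<otimes> ?c" using x s by (simp add: m_assoc)
    also have "\<dots> = ?c [^] m \<otimes> (x \<otimes> ?c)" using Suc x s by (simp add: m_assoc)
    also have "\<dots> = ?c [^] Suc m \<otimes> x" using x s c by (simp add: m_assoc)
    finally show ?case .
  qed (use x in simp)
  then have "x \<otimes> ?c [^] m \<otimes> inv x = ?c [^] m"
    using x s by (simp add: m_assoc)
  moreover have "x [^] Suc m = x \<otimes> x [^] m"
    using x by (metis nat_pow_Suc2)
  ultimately show ?case
    using Suc x s by (simp add: commutator_mult_left)
qed

text \<open>The commutator becomes central in \<open>G Mod N\<close>, so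
  \<open>commutator_pow_left\<close> applies to the images there.\<close>

lemma commutator_pow_left_mod:
  assumes N: "N \<lhd> G" and x: "x \<in> carrier G" and s: "s \<in> carrier G"
    and c: "commutator x s \<in> centralizer_mod N (carrier G)"
    and m: "commutator x s [^] (m::nat) \<in> N"
  shows "commutator (x [^] m) s \<in> N"
proof -
  interpret Q: group_hom G "G Mod N" "\<lambda>a. N #> a" by (rule group_hom_rcoset[OF N])
  let ?f = "\<lambda>a. N #> a" and ?c = "commutator x s"
  have f: "?f (commutator a b) = Q.H.commutator (?f a) (?f b)"
    if "a \<in> carrier G" "b \<in> carrier G" for a b
    using that Q.hom_mult Q.hom_inv by (simp only: commutator_def Q.H.commutator_def m_closed inv_closed)
  have "commutator ?c x \<in> N" using c x by (simp add: centralizer_mod_def)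
  then have "?f (?c \<otimes> x) = ?f (x \<otimes> ?c)"
    using mult_eq_commutator(1)[of ?c x] x s rcoset_eq_one_iff[OF N, of "commutator ?c x"]
    by (metis Q.hom_closed Q.hom_mult Q.H.l_one commutator_closed m_closed)
  then have "?f x \<otimes>\<^bsub>G Mod N\<^esub> Q.H.commutator (?f x) (?f s)
      = Q.H.commutator (?f x) (?f s) \<otimes>\<^bsub>G Mod N\<^esub> ?f x"
    using x s Q.hom_mult f by (metis commutator_closed)
  then have "Q.H.commutator (?f x [^]\<^bsub>G Mod N\<^esub> m) (?f s)
      = Q.H.commutator (?f x) (?f s) [^]\<^bsub>G Mod N\<^esub> m"
    using x s by (intro Q.H.commutator_pow_left) (auto intro: Q.hom_closed)
  then have "?f (commutator (x [^] m) s) = ?f (?c [^] m)"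
    using x s f Q.hom_nat_pow by (metis commutator_closed nat_pow_closed)
  then show ?thesis
    using x s m rcoset_eq_one_iff[OF N] by (metis commutator_closed nat_pow_closed)
qed

section \<open>Central series above a normal subgroup\<close>

text \<open>For normal \<open>N\<close>, the preimages of the upper central series of
  \<open>G Mod N\<close>, starting with the trivial subgroup at index 0.\<close>

primrec upper_central_mod :: "'a set \<Rightarrow> nat \<Rightarrow> 'a set" where
  "upper_central_mod N 0 = N"
| "upper_central_mod N (Suc i) = centralizer_mod (upper_central_mod N i) (carrier G)"

text \<open>For normal \<open>N\<close>, the preimages of the lower central series of
  \<open>G Mod N\<close>; adjoining \<open>N\<close> keeps every term above
  \<open>N\<close>.\<close>

primrec lower_central_mod :: "'a set \<Rightarrow> nat \<Rightarrow> 'a set" where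
  "lower_central_mod N 0 = carrier G"
| "lower_central_mod N (Suc i) =
     generate G ((\<Union>a \<in> lower_central_mod N i. commutator a ` carrier G) \<union> N)"

lemma upper_central_mod_normal:
  assumes "N \<lhd> G"
  shows "upper_central_mod N i \<lhd> G"
  using assms by (induction i) (simp_all add: centralizer_mod_normal)

lemma subset_upper_central_mod:
  assumes "N \<lhd> G"
  shows "N \<subseteq> upper_central_mod N i"
proof (induction i)
  case (Suc i)
  then show ?case
    using subset_centralizer_mod[OF upper_central_mod_normal[OF assms, of i]] by auto
qed simp

text \<open>The lower central series is read from its trivial end:
  \<open>lower_central G (c - j)\<close> lies in \<open>upper_central_mod N j\<close>, and
  \<open>j = c\<close> gives the whole group.\<close>

lemma upper_central_mod_eq_carrier:
  assumes N: "N \<lhd> G" and c: "lower_central G c = {\<one>}"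
  shows "upper_central_mod N c = carrier G"
proof -
  have "lower_central G (c - j) \<subseteq> upper_central_mod N j" if "j \<le> c" for j
    using that
  proof (induction j)
    case 0
    then show ?case
      using c subgroup.one_closed[OF normal_imp_subgroup[OF N]] by simp
  next
    case (Suc j)
    have "lower_central G (Suc (c - Suc j)) \<subseteq> upper_central_mod N j"
      using Suc by (simp add: Suc_diff_Suc del: lower_central.simps)
    then have "commutator a b \<in> upper_central_mod N j"
      if "a \<in> lower_central G (c - Suc j)" "b \<in> carrier G" for a b
      using that unfolding lower_central.simps commutator_subgroup_def commutator_def
      by (blast intro: generate.incl)
    then show ?case
      using lower_central_in_carrier[OF is_group, of "c - Suc j"]
      by (auto simp: centralizer_mod_def)
  qed
  from this[of c] have "carrier G \<subseteq> upper_central_mod N c" by simp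
  then show ?thesis
    using normal_imp_subgroup[OF upper_central_mod_normal[OF N]] subgroup.subset by blast
qed

text \<open>Normality and descent need a joint induction: conjugating \<open>h\<close> multiplies it
  by the inverse of a commutator of \<open>h\<close>, and this commutator lies in the next term
  because \<open>h\<close> also lies in the current one.\<close>

lemma lower_central_mod_normal:
  assumes N: "N \<lhd> G"
  shows "lower_central_mod N i \<lhd> G \<and> lower_central_mod N (Suc i) \<subseteq> lower_central_mod N i
     \<and> N \<subseteq> lower_central_mod N i"
proof (induction i)
  case 0
  have "N \<subseteq> carrier G" using normal_imp_subgroup[OF N] subgroup.subset by blast
  then have "lower_central_mod N (Suc 0) \<subseteq> carrier G"
    unfolding lower_central_mod.simps by (intro generate_incl) auto
  then show ?case
    using \<open>N \<subseteq> carrier G\<close> by (simp add: normal_inv_iff subgroup_self)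
next
  case (Suc i)
  let ?A = "lower_central_mod N i" and ?B = "lower_central_mod N (Suc i)"
  let ?C = "lower_central_mod N (Suc (Suc i))"
  let ?S = "(\<Union>a \<in> ?A. commutator a ` carrier G) \<union> N"
  have A: "?A \<lhd> G" "?B \<subseteq> ?A" "N \<subseteq> ?A" using Suc by auto
  have Ac: "?A \<subseteq> carrier G" using normal_imp_subgroup[OF A(1)] subgroup.subset by blast
  have S: "?S \<subseteq> carrier G" using Ac A(3) by blast
  have sB: "subgroup ?B G" using generate_is_subgroup[OF S] by simp
  have SB: "?S \<subseteq> ?B" using generate_superset[of ?S] by simp
  have B: "?B \<lhd> G"
    unfolding normal_inv_iff
  proof (intro conjI ballI sB)
    fix x h assume x: "x \<in> carrier G" and h: "h \<in> ?B"
    then have "commutator h x \<in> ?B" using A(2) SB by blast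
    moreover have "h \<in> carrier G" using h A(2) Ac by blast
    ultimately show "x \<otimes> h \<otimes> inv x \<in> ?B"
      using conjugate_eq_commutator[of h x] x h sB
      by (simp add: subgroup.m_closed subgroup.m_inv_closed del: lower_central_mod.simps)
  qed
  moreover have "?C \<subseteq> ?B"
    unfolding lower_central_mod.simps(2)[of N "Suc i"]
    using SB sB commutator_normal(1)[OF B] by (intro generate_subgroup_incl) auto
  moreover have "N \<subseteq> ?B" using SB by blast
  ultimately show ?case by blast
qed

lemma lower_central_mod_subset_upper:
  assumes N: "N \<lhd> G" and c: "upper_central_mod N c = carrier G"
  shows "i \<le> c \<Longrightarrow> lower_central_mod N i \<subseteq> upper_central_mod N (c - i)"
proof (induction i)
  case (Suc i)
  have "lower_central_mod N i \<subseteq> upper_central_mod N (Suc (c - Suc i))"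
    using Suc by (simp add: Suc_diff_Suc del: upper_central_mod.simps)
  then show ?case
    unfolding lower_central_mod.simps
    using subset_upper_central_mod[OF N] normal_imp_subgroup[OF upper_central_mod_normal[OF N]]
    by (intro generate_subgroup_incl) (auto simp: centralizer_mod_def)
qed (simp add: c)

text \<open>Commutators of generators of one factor with generators of \<open>G\<close> generate the
  next factor, since commutation is bilinear modulo the term after it. Centralizers modulo
  \<open>L\<close> take the place of the explicit bilinear computation.\<close>

lemma lower_central_mod_finitely_generated:
  assumes N: "N \<lhd> G" and S: "finite S" "S \<subseteq> carrier G" "generate G S = carrier G"
  shows "\<exists>X. finite X \<and> X \<subseteq> lower_central_mod N i \<and>
    lower_central_mod N i \<subseteq> generate G (X \<union> lower_central_mod N (Suc i))"
proof (induction i)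
  case 0
  show ?case
    using S mono_generate[of S "S \<union> lower_central_mod N (Suc 0)"] by (auto intro!: exI[of _ S])
next
  case (Suc i)
  let ?A = "lower_central_mod N i" and ?B = "lower_central_mod N (Suc i)"
  let ?C = "lower_central_mod N (Suc (Suc i))"
  from Suc obtain X where X: "finite X" "X \<subseteq> ?A" "?A \<subseteq> generate G (X \<union> ?B)" by blast
  have A: "?A \<lhd> G" "?B \<subseteq> ?A" and B: "?B \<lhd> G" "?C \<subseteq> ?B" "N \<subseteq> ?C"
    using lower_central_mod_normal[OF N] by blast+
  have sub: "?A \<subseteq> carrier G" "?B \<subseteq> carrier G"
    using A B normal_imp_subgroup subgroup.subset by blast+
  let ?Y = "(\<lambda>(x, s). commutator x s) ` (X \<times> S)"
  have Y: "?Y \<subseteq> ?B"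
    using X(2) S(2) generate_superset by (fastforce simp: image_iff)
  define L where "L = generate G (?Y \<union> ?C)"
  have LB: "L \<subseteq> ?B"
    unfolding L_def using Y B by (intro generate_subgroup_incl normal_imp_subgroup) auto
  have CL: "?C \<subseteq> L" and YL: "?Y \<subseteq> L"
    unfolding L_def using generate_superset[of "?Y \<union> ?C"] by blast+
  have BC: "commutator b y \<in> ?C" if "b \<in> ?B" "y \<in> carrier G" for b y
    unfolding lower_central_mod.simps(2)[of N "Suc i"] using that by (blast intro: generate.incl)
  have sL: "subgroup L G"
    unfolding L_def using Y B(2) sub by (intro generate_is_subgroup) blast
  \<comment> \<open>\<open>?B\<close> is central modulo \<open>?C\<close>, so every subgroup between
    the two is normal.\<close>
  have "L \<lhd> G"
    using CL BC LB sub by (intro normal_between_centralizer[OF sL CL]) (auto simp: centralizer_mod_def)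
  note sc = subgroup_centralizer_mod[OF this]
  \<comment> \<open>Commuting modulo \<open>L\<close> is checked on generators in both arguments and
    then extended to \<open>?A\<close> and \<open>G\<close>; this forces \<open>?B\<close> into
    \<open>L\<close>.\<close>
  have "X \<union> ?B \<subseteq> centralizer_mod L S"
  proof
    fix a assume a: "a \<in> X \<union> ?B"
    have "commutator a s \<in> L" if "s \<in> S" for s
    proof (cases "a \<in> X")
      case True
      then show ?thesis using YL that by blast
    next
      case False
      then show ?thesis using BC[of a s] CL a that S(2) by blast
    qed
    moreover have "a \<in> carrier G" using a X(2) sub by blast
    ultimately show "a \<in> centralizer_mod L S" by (simp add: centralizer_mod_def)
  qed
  then have "generate G (X \<union> ?B) \<subseteq> centralizer_mod L S"
    by (rule generate_subgroup_incl) (rule sc[OF S(2)])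
  then have "?A \<subseteq> centralizer_mod L (generate G S)"
    using X(3) by (intro centralizer_mod_generate[OF \<open>L \<lhd> G\<close> S(2)]) blast
  then have "?B \<subseteq> L"
    unfolding lower_central_mod.simps(2)[of N i] S(3) using CL B(3)
    by (intro generate_subgroup_incl[OF _ sL]) (auto simp: centralizer_mod_def)
  then show ?case
    using Y X(1) S(1) unfolding L_def by (intro exI[of _ ?Y]) auto
qed

text \<open>Torsion climbs the series: for \<open>x\<close> one level higher, each
  \<open>commutator x s\<close> with \<open>s\<close> a generator has a \<open>p\<close>-power one
  level further down. As there are finitely many generators, one power of \<open>x\<close> commutes
  with all of them modulo that level.\<close>

lemma pow_in_upper_central_mod:
  assumes N: "N \<lhd> G" and S: "finite S" "S \<subseteq> carrier G" "generate G S = carrier G"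
    and T: "\<And>z. z \<in> centralizer_mod N (carrier G) \<Longrightarrow> \<exists>k. z [^] (p ^ k) \<in> N"
  shows "x \<in> upper_central_mod N (Suc i) \<Longrightarrow> \<exists>k. x [^] ((p::nat) ^ k) \<in> upper_central_mod N i"
proof (induction i arbitrary: x)
  case 0
  then show ?case using T by simp
next
  case (Suc i)
  let ?Z = "upper_central_mod N"
  have Z: "?Z j \<lhd> G" for j by (rule upper_central_mod_normal[OF N])
  have x: "x \<in> carrier G" and xs: "commutator x s \<in> ?Z (Suc i)" if "s \<in> carrier G" for s
    using Suc.prems that by (auto simp: centralizer_mod_def)
  have x: "x \<in> carrier G" using x[OF one_closed] .
  obtain k where k: "commutator x s [^] (p ^ k s) \<in> ?Z i" if "s \<in> S" for s
    using Suc.IH[OF xs] S(2) by (metis subsetD)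
  \<comment> \<open>A common exponent: \<open>k s\<close> is at most \<open>m\<close> for every
    \<open>s\<close> in \<open>S\<close>.\<close>
  define m where "m = (\<Sum>s\<in>S. k s)"
  have "commutator (x [^] (p ^ m)) s \<in> ?Z i" if s: "s \<in> S" for s
  proof (rule commutator_pow_left_mod[OF Z x])
    show sc: "s \<in> carrier G" using s S(2) by blast
    show "commutator x s \<in> centralizer_mod (?Z i) (carrier G)" using xs[OF sc] by simp
    have "k s \<le> m" unfolding m_def using s S(1) by (intro member_le_sum) auto
    then have "commutator x s [^] (p ^ m) = (commutator x s [^] (p ^ k s)) [^] (p ^ (m - k s))"
      using x sc by (simp add: nat_pow_pow flip: power_add)
    also have "\<dots> \<in> ?Z i"
      using k[OF s] normal_imp_subgroup[OF Z[of i]]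
      by (metis int_pow_int subgroup_int_pow_closed)
    finally show "commutator x s [^] (p ^ m) \<in> ?Z i" .
  qed
  then have "{x [^] (p ^ m)} \<subseteq> centralizer_mod (?Z i) S"
    using x by (auto simp: centralizer_mod_def)
  from centralizer_mod_generate[OF Z S(2) this] have "x [^] (p ^ m) \<in> ?Z (Suc i)"
    by (simp add: S(3))
  then show ?case by blast
qed

lemma prime_power_torsion_mod:
  assumes N: "N \<lhd> G" and S: "finite S" "S \<subseteq> carrier G" "generate G S = carrier G"
    and T: "\<And>z. z \<in> centralizer_mod N (carrier G) \<Longrightarrow> \<exists>k. z [^] (p ^ k) \<in> N"
    and c: "upper_central_mod N c = carrier G" and x: "x \<in> carrier G"
  shows "\<exists>k. x [^] ((p::nat) ^ k) \<in> N"
proof -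
  have "x \<in> upper_central_mod N i \<Longrightarrow> \<exists>k. x [^] (p ^ k) \<in> N" for i
    using x
  proof (induction i arbitrary: x)
    case 0
    then show ?case by (metis power_0 nat_pow_eone upper_central_mod.simps(1))
  next
    case (Suc i)
    obtain k where "x [^] (p ^ k) \<in> upper_central_mod N i"
      using pow_in_upper_central_mod[OF N S T Suc.prems(1)] by blast
    then obtain l where "(x [^] (p ^ k)) [^] (p ^ l) \<in> N"
      using Suc by blast
    then show ?case
      using Suc.prems(2) by (metis nat_pow_pow power_add)
  qed
  then show ?thesis using x c by blast
qed

end

section \<open>Polynomial functions modulo a prime\<close>

context group
begin

abbreviation difference :: "'a \<Rightarrow> ('a \<Rightarrow> int) \<Rightarrow> 'a \<Rightarrow> int" where
  "difference x v \<equiv> \<lambda>y. v (y \<otimes> x) - v y"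

text \<open>
  Degree less than \<open>n\<close>: as functions to the integers modulo \<open>p\<close>, these are the functions
  annihilated by the \<open>n\<close>-th power of the augmentation ideal, acting by right translation.
\<close>

primrec polynomial_mod :: "nat \<Rightarrow> nat \<Rightarrow> ('a \<Rightarrow> int) \<Rightarrow> bool" where
  "polynomial_mod p 0 v \<longleftrightarrow> (\<forall>y \<in> carrier G. int p dvd v y)"
| "polynomial_mod p (Suc n) v \<longleftrightarrow> (\<forall>x \<in> carrier G. polynomial_mod p n (difference x v))"

text \<open>For normal \<open>N\<close> these are the integer lifts of functions from
  \<open>G Mod N\<close> to the integers modulo \<open>p\<close>.\<close>

definition right_invariant_mod :: "nat \<Rightarrow> 'a set \<Rightarrow> ('a \<Rightarrow> int) \<Rightarrow> bool" where
  "right_invariant_mod p N v \<longleftrightarrow> (\<forall>y \<in> carrier G. \<forall>a \<in> N. int p dvd v (y \<otimes> a) - v y)"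

text \<open>One degree bound serves all functions. For normal \<open>N\<close> and prime
  \<open>p\<close> this is the dual form of nilpotency of the augmentation ideal of
  \<open>G Mod N\<close> in characteristic \<open>p\<close>.\<close>

definition invariants_polynomial :: "nat \<Rightarrow> 'a set \<Rightarrow> bool" where
  "invariants_polynomial p N \<longleftrightarrow> (\<exists>n. \<forall>v. right_invariant_mod p N v \<longrightarrow> polynomial_mod p n v)"

section \<open>Closure properties of polynomial functions\<close>

lemma polynomial_mod_cong:
  assumes "\<And>y. y \<in> carrier G \<Longrightarrow> int p dvd u y - v y" "polynomial_mod p n u"
  shows "polynomial_mod p n v"
  using assms
proof (induction n arbitrary: u v)
  case 0
  then show ?case by (metis dvd_diff_commute dvd_diffD polynomial_mod.simps(1) zdvd_zdiffD)
next
  case (Suc n)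
  have "polynomial_mod p n (difference x v)" if x: "x \<in> carrier G" for x
  proof (rule Suc.IH)
    show "polynomial_mod p n (difference x u)" using Suc.prems x by simp
    show "int p dvd difference x u y - difference x v y" if y: "y \<in> carrier G" for y
      using dvd_diff[OF Suc.prems(1)[of "y \<otimes> x"] Suc.prems(1)[OF y]] x y
      by (simp add: algebra_simps)
  qed
  then show ?case by simp
qed

lemma polynomial_mod_add:
  assumes "polynomial_mod p n u" "polynomial_mod p n v"
  shows "polynomial_mod p n (\<lambda>y. u y + v y)"
  using assms
proof (induction n arbitrary: u v)
  case (Suc n)
  have "polynomial_mod p n (\<lambda>y. difference x u y + difference x v y)" if "x \<in> carrier G" for x
    using Suc.prems that by (intro Suc.IH) auto
  then show ?case by (simp add: algebra_simps)
qed simp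

lemma polynomial_mod_uminus:
  assumes "polynomial_mod p n u"
  shows "polynomial_mod p n (\<lambda>y. - u y)"
  using assms
proof (induction n arbitrary: u)
  case (Suc n)
  have "polynomial_mod p n (\<lambda>y. - difference x u y)" if "x \<in> carrier G" for x
    using Suc.prems that by (intro Suc.IH) auto
  then show ?case by (simp add: algebra_simps)
qed simp

lemma polynomial_mod_diff:
  assumes "polynomial_mod p n u" "polynomial_mod p n v"
  shows "polynomial_mod p n (\<lambda>y. u y - v y)"
  using polynomial_mod_add[OF assms(1) polynomial_mod_uminus[OF assms(2)]] by simp

lemma polynomial_mod_zero: "polynomial_mod p n (\<lambda>y. 0)"
  by (induction n) auto

text \<open>A difference of a translate is the translate of a difference along a conjugate, because
  \<open>y \<otimes> a \<otimes> x\<close> equals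
  \<open>y \<otimes> x \<otimes> (inv x \<otimes> a \<otimes> x)\<close>.\<close>

lemma polynomial_mod_translate:
  assumes "x \<in> carrier G" "polynomial_mod p n u"
  shows "polynomial_mod p n (\<lambda>y. u (y \<otimes> x))"
  using assms(2)
proof (induction n arbitrary: u)
  case (Suc n)
  have "polynomial_mod p n (difference a (\<lambda>y. u (y \<otimes> x)))" if a: "a \<in> carrier G" for a
  proof (rule polynomial_mod_cong)
    show "polynomial_mod p n (\<lambda>y. difference (inv x \<otimes> a \<otimes> x) u (y \<otimes> x))"
      using Suc.prems a assms(1) by (intro Suc.IH) simp
    show "int p dvd difference (inv x \<otimes> a \<otimes> x) u (y \<otimes> x) - difference a (\<lambda>y. u (y \<otimes> x)) y"
      if "y \<in> carrier G" for y
      using a that assms(1) by (simp add: group_normalize)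
  qed
  then show ?case by simp
qed (use assms(1) in simp)

text \<open>Right translation by \<open>x\<close> is the identity plus the operator
  \<open>difference x\<close>; this is the binomial theorem for its \<open>n\<close>-th
  power.\<close>

lemma translate_eq_sum_differences:
  assumes "x \<in> carrier G" "y \<in> carrier G"
  shows "v (y \<otimes> x [^] n) = (\<Sum>j\<le>n. of_nat (n choose j) * (difference x ^^ j) v y)"
proof (induction n arbitrary: v)
  case 0
  then show ?case using assms by simp
next
  case (Suc n)
  let ?d = "\<lambda>j. (difference x ^^ j) v y"
  have "v (y \<otimes> x [^] Suc n) = v (y \<otimes> x [^] n) + difference x v (y \<otimes> x [^] n)"
    using assms by (simp add: m_assoc)
  also have "\<dots> = (\<Sum>j\<le>n. of_nat (n choose j) * ?d j) + (\<Sum>j\<le>n. of_nat (n choose j) * ?d (Suc j))"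
    using Suc[of v] Suc[of "difference x v"] by (simp only: funpow_Suc_right o_apply)
  also have "(\<Sum>j\<le>n. of_nat (n choose j) * ?d j) = (\<Sum>j\<le>Suc n. of_nat (n choose j) * ?d j)"
    by simp
  also have "\<dots> = ?d 0 + (\<Sum>j\<le>n. of_nat (n choose Suc j) * ?d (Suc j))"
    by (subst sum.atMost_Suc_shift) simp
  also have "\<dots> + (\<Sum>j\<le>n. of_nat (n choose j) * ?d (Suc j))
      = ?d 0 + (\<Sum>j\<le>n. of_nat (Suc n choose Suc j) * ?d (Suc j))"
    by (simp add: sum.distrib[symmetric] algebra_simps del: funpow.simps)
  also have "\<dots> = (\<Sum>j\<le>Suc n. of_nat (Suc n choose j) * ?d j)"
    by (subst sum.atMost_Suc_shift) simp
  finally show ?case .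
qed

text \<open>The inner binomial coefficients are divisible by \<open>p\<close>, so only the two
  extreme terms of the expansion survive.\<close>

lemma prime_difference_funpow:
  assumes p: "prime p" and "x \<in> carrier G" "y \<in> carrier G"
  shows "int p dvd (v (y \<otimes> x [^] p) - v y) - (difference x ^^ p) v y"
proof -
  let ?f = "\<lambda>j. int (p choose j) * (difference x ^^ j) v y"
  have p0: "0 < p" using p prime_gt_0_nat by blast
  have "{..p} = insert 0 (insert p {0<..<p})" using p0 by auto
  then have "v (y \<otimes> x [^] p) = ?f 0 + (?f p + sum ?f {0<..<p})"
    using translate_eq_sum_differences[OF assms(2,3), of v p] p0 by simp
  moreover have "int p dvd sum ?f {0<..<p}"
    using p by (intro dvd_sum dvd_mult2) (simp add: dvd_choose_prime)
  ultimately show ?thesis by simp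
qed

section \<open>Functions invariant under a normal subgroup\<close>

lemma right_invariant_mod_difference:
  assumes N: "N \<lhd> G" and v: "right_invariant_mod p N v" and x: "x \<in> carrier G"
  shows "right_invariant_mod p N (difference x v)"
  unfolding right_invariant_mod_def
proof (intro ballI)
  interpret N: normal N G by fact
  fix y a assume y: "y \<in> carrier G" and a: "a \<in> N"
  have ac: "a \<in> carrier G" using a by simp
  have eq: "y \<otimes> a \<otimes> x = y \<otimes> x \<otimes> (inv x \<otimes> a \<otimes> x)" using x y ac by (simp add: group_normalize)
  have "int p dvd v (y \<otimes> x \<otimes> (inv x \<otimes> a \<otimes> x)) - v (y \<otimes> x)" "int p dvd v (y \<otimes> a) - v y"
    using v x y a N.inv_op_closed1[OF x a] by (auto simp: right_invariant_mod_def)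
  from dvd_diff[OF this] show "int p dvd difference x v (y \<otimes> a) - difference x v y"
    unfolding eq by (simp add: algebra_simps)
qed

text \<open>The products \<open>x \<otimes> a\<close> and \<open>a \<otimes> x\<close> differ by a
  right factor in \<open>N\<close>, which \<open>v\<close> does not see modulo
  \<open>p\<close>.\<close>

lemma difference_commute_mod:
  assumes "N \<lhd> G" and v: "right_invariant_mod p N v" and x: "x \<in> centralizer_mod N (carrier G)"
    and a: "a \<in> carrier G" and y: "y \<in> carrier G"
  shows "int p dvd difference a (difference x v) y - difference x (difference a v) y"
proof -
  have xc: "x \<in> carrier G" using x by (simp add: centralizer_mod_def)
  have "inv x \<in> centralizer_mod N (carrier G)"
    using x subgroup_centralizer_mod[OF assms(1)] by (simp add: subgroup.m_inv_closed)
  then have n: "commutator (inv x) (inv a) \<in> N" using a by (simp add: centralizer_mod_def)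
  have "y \<otimes> x \<otimes> a = y \<otimes> a \<otimes> x \<otimes> commutator (inv x) (inv a)"
    using mult_eq_commutator(2)[OF xc a] xc a y by (simp add: m_assoc)
  moreover have "int p dvd v (y \<otimes> a \<otimes> x \<otimes> commutator (inv x) (inv a)) - v (y \<otimes> a \<otimes> x)"
    using v n xc a y by (simp add: right_invariant_mod_def)
  ultimately have "int p dvd v (y \<otimes> x \<otimes> a) - v (y \<otimes> a \<otimes> x)" by simp
  then show ?thesis by (simp add: algebra_simps dvd_diff_commute)
qed

lemma right_invariant_mod_generate:
  assumes "N \<subseteq> carrier G" and v: "right_invariant_mod p N v"
  shows "right_invariant_mod p (generate G N) v"
proof -
  \<comment> \<open>The stabilizer of \<open>v\<close> modulo \<open>p\<close> under right
    translation.\<close>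
  let ?U = "{a \<in> carrier G. \<forall>y \<in> carrier G. int p dvd v (y \<otimes> a) - v y}"
  have "subgroup ?U G"
  proof (rule subgroupI)
    show "?U \<noteq> {}" using r_one by force
  next
    fix a assume a: "a \<in> ?U"
    have "int p dvd v (y \<otimes> inv a) - v y" if "y \<in> carrier G" for y
    proof -
      have "int p dvd v (y \<otimes> inv a \<otimes> a) - v (y \<otimes> inv a)" using a that by blast
      then show ?thesis using a that by (simp add: m_assoc dvd_diff_commute)
    qed
    then show "inv a \<in> ?U" using a by simp
  next
    fix a b assume a: "a \<in> ?U" and b: "b \<in> ?U"
    have "int p dvd v (y \<otimes> (a \<otimes> b)) - v y" if y: "y \<in> carrier G" for y
    proof -
      have "int p dvd v (y \<otimes> a \<otimes> b) - v (y \<otimes> a)" "int p dvd v (y \<otimes> a) - v y"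
        using a b y by auto
      from dvd_add[OF this] show ?thesis using a b y by (simp add: m_assoc)
    qed
    then show "a \<otimes> b \<in> ?U" using a b by simp
  qed auto
  then have "generate G N \<subseteq> ?U"
    using assms by (intro generate_subgroup_incl) (auto simp: right_invariant_mod_def)
  then show ?thesis by (auto simp: right_invariant_mod_def)
qed

text \<open>Induction on \<open>m\<close>: if \<open>difference x v\<close> vanishes modulo
  \<open>p\<close>, then \<open>v\<close> is also invariant under \<open>x\<close> and
  \<open>n\<close> applies. Otherwise each further difference lowers the degree of
  \<open>difference x v\<close>, as the two operators commute modulo \<open>p\<close>.\<close>

lemma polynomial_mod_if_difference:
  assumes N: "N \<lhd> G" and x: "x \<in> centralizer_mod N (carrier G)"
    and n: "\<And>v. right_invariant_mod p (generate G (insert x N)) v \<Longrightarrow> polynomial_mod p n v"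
  shows "right_invariant_mod p N v \<Longrightarrow> polynomial_mod p m (difference x v)
    \<Longrightarrow> polynomial_mod p (m + n) v"
proof (induction m arbitrary: v)
  case 0
  have "insert x N \<subseteq> carrier G"
    using x normal_imp_subgroup[OF N] subgroup.subset by (auto simp: centralizer_mod_def)
  moreover have "right_invariant_mod p (insert x N) v"
    using 0 by (auto simp: right_invariant_mod_def)
  ultimately show ?case using right_invariant_mod_generate n by simp
next
  case (Suc m)
  have "polynomial_mod p (m + n) (difference a v)" if a: "a \<in> carrier G" for a
  proof (rule Suc.IH)
    show "right_invariant_mod p N (difference a v)"
      by (rule right_invariant_mod_difference[OF N Suc.prems(1) a])
    show "polynomial_mod p m (difference x (difference a v))"
    proof (rule polynomial_mod_cong)
      show "polynomial_mod p m (difference a (difference x v))"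
        using Suc.prems(2) a by simp
    qed (rule difference_commute_mod[OF N Suc.prems(1) x a])
  qed
  then show ?case by simp
qed

text \<open>Each of the \<open>i\<close> applications of \<open>difference x\<close> costs at most
  \<open>n\<close> degrees.\<close>

lemma polynomial_mod_if_funpow_difference:
  assumes N: "N \<lhd> G" and x: "x \<in> centralizer_mod N (carrier G)"
    and n: "\<And>v. right_invariant_mod p (generate G (insert x N)) v \<Longrightarrow> polynomial_mod p n v"
  shows "right_invariant_mod p N v \<Longrightarrow> \<forall>y \<in> carrier G. int p dvd (difference x ^^ i) v y
    \<Longrightarrow> polynomial_mod p (i * n) v"
proof (induction i arbitrary: v)
  case (Suc i)
  have "x \<in> carrier G" using x by (simp add: centralizer_mod_def)
  then have "polynomial_mod p (i * n) (difference x v)"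
    using Suc.prems by (intro Suc.IH right_invariant_mod_difference[OF N])
      (simp_all only: funpow_Suc_right o_apply)
  from polynomial_mod_if_difference[OF N x n Suc.prems(1) this] show ?case
    by (simp add: add.commute)
qed simp

text \<open>The \<open>p\<close>-th iterate of \<open>difference x\<close> is, modulo
  \<open>p\<close>, the difference along \<open>x [^] p\<close>, and this kills \<open>v\<close>
  because \<open>x [^] p\<close> lies in \<open>N\<close>.\<close>

lemma invariants_polynomial_prime_step:
  assumes p: "prime p" and N: "N \<lhd> G" and x: "x \<in> centralizer_mod N (carrier G)"
    and xp: "x [^] p \<in> N" and I: "invariants_polynomial p (generate G (insert x N))"
  shows "invariants_polynomial p N"
proof -
  have xc: "x \<in> carrier G" using x by (simp add: centralizer_mod_def)
  obtain n where n: "\<And>v. right_invariant_mod p (generate G (insert x N)) v \<Longrightarrow> polynomial_mod p n v"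
    using I by (auto simp: invariants_polynomial_def)
  have "polynomial_mod p (p * n) v" if v: "right_invariant_mod p N v" for v
  proof (rule polynomial_mod_if_funpow_difference[OF N x n v])
    show "\<forall>y \<in> carrier G. int p dvd (difference x ^^ p) v y"
    proof
      fix y assume y: "y \<in> carrier G"
      have "int p dvd v (y \<otimes> x [^] p) - v y" using v xp y by (simp add: right_invariant_mod_def)
      then show "int p dvd (difference x ^^ p) v y"
        using dvd_diff[OF _ prime_difference_funpow[OF p xc y, of v]] by fastforce
    qed
  qed
  then show ?thesis by (auto simp: invariants_polynomial_def)
qed

section \<open>Adjoining central elements of prime power order\<close>

lemma central_extension_normal:
  assumes N: "N \<lhd> G" and X: "X \<subseteq> centralizer_mod N (carrier G)"
  shows "generate G (X \<union> N) \<lhd> G" "generate G (X \<union> N) \<subseteq> centralizer_mod N (carrier G)"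
proof -
  have XN: "X \<union> N \<subseteq> centralizer_mod N (carrier G)" using X subset_centralizer_mod[OF N] by blast
  then show sub: "generate G (X \<union> N) \<subseteq> centralizer_mod N (carrier G)"
    by (rule generate_subgroup_incl) (rule subgroup_centralizer_mod[OF N subset_refl])
  have "subgroup (generate G (X \<union> N)) G"
    using XN centralizer_mod_subset by (intro generate_is_subgroup) blast
  moreover have "N \<subseteq> generate G (X \<union> N)" using generate_superset[of "X \<union> N"] by blast
  ultimately show "generate G (X \<union> N) \<lhd> G" using sub by (rule normal_between_centralizer)
qed

lemma centralizer_mod_mono: "N \<subseteq> N' \<Longrightarrow> centralizer_mod N T \<subseteq> centralizer_mod N' T"
  by (auto simp: centralizer_mod_def)

lemma right_invariant_mod_mono:
  "right_invariant_mod p N' v \<Longrightarrow> N \<subseteq> N' \<Longrightarrow> right_invariant_mod p N v"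
  by (auto simp: right_invariant_mod_def)

lemma invariants_polynomial_mono:
  "invariants_polynomial p N \<Longrightarrow> N \<subseteq> N' \<Longrightarrow> invariants_polynomial p N'"
  unfolding invariants_polynomial_def using right_invariant_mod_mono by blast

text \<open>\<open>x [^] p\<close> is adjoined to \<open>N\<close> first, with the smaller exponent
  \<open>k\<close>; above that subgroup \<open>x\<close> has order dividing
  \<open>p\<close>.\<close>

lemma invariants_polynomial_prime_power_step:
  assumes p: "prime p"
  shows "N \<lhd> G \<Longrightarrow> x \<in> centralizer_mod N (carrier G) \<Longrightarrow> x [^] (p ^ k) \<in> N
    \<Longrightarrow> invariants_polynomial p (generate G (insert x N)) \<Longrightarrow> invariants_polynomial p N"
proof (induction k arbitrary: x)
  case 0
  then have "x \<in> N" using nat_pow_eone by (simp add: centralizer_mod_def)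
  then have "generate G (insert x N) \<subseteq> N"
    using normal_imp_subgroup[OF 0(1)] by (intro generate_subgroup_incl) auto
  then show ?case using 0(4) invariants_polynomial_mono by blast
next
  case (Suc k)
  have x: "x \<in> carrier G" using Suc.prems by (simp add: centralizer_mod_def)
  let ?N = "generate G (insert (x [^] p) N)"
  have xp: "x [^] p \<in> centralizer_mod N (carrier G)"
    using Suc.prems(2) subgroup_centralizer_mod[OF Suc.prems(1) subset_refl]
    by (metis int_pow_int subgroup_int_pow_closed)
  have sub: "insert (x [^] p) N \<subseteq> ?N" by (rule generate_superset)
  show ?case
  proof (rule Suc.IH[OF Suc.prems(1) xp])
    show "(x [^] p) [^] (p ^ k) \<in> N" using Suc.prems(3) x by (simp add: nat_pow_pow)
    show "invariants_polynomial p ?N"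
    proof (rule invariants_polynomial_prime_step[OF p])
      show "?N \<lhd> G" using central_extension_normal(1)[OF Suc.prems(1), of "{x [^] p}"] xp by simp
      show "x \<in> centralizer_mod ?N (carrier G)"
        using Suc.prems(2) centralizer_mod_mono[of N ?N] sub by blast
      show "x [^] p \<in> ?N" using sub by blast
      show "invariants_polynomial p (generate G (insert x ?N))"
        using Suc.prems(4)
        by (rule invariants_polynomial_mono) (intro mono_generate insert_mono, use sub in blast)
    qed
  qed
qed

lemma invariants_polynomial_finite_step:
  assumes p: "prime p" and "finite X"
  shows "N \<lhd> G \<Longrightarrow> X \<subseteq> centralizer_mod N (carrier G) \<Longrightarrow> \<forall>x \<in> X. \<exists>k. x [^] (p ^ k) \<in> N
    \<Longrightarrow> invariants_polynomial p (generate G (X \<union> N)) \<Longrightarrow> invariants_polynomial p N"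
  using assms(2)
proof (induction X arbitrary: N rule: finite_induct)
  case empty
  have "generate G N \<subseteq> N"
    using normal_imp_subgroup[OF empty(1)] by (intro generate_subgroup_incl) auto
  then show ?case using empty(4) invariants_polynomial_mono by simp
next
  case (insert x X)
  let ?N = "generate G (insert x N)"
  have x: "x \<in> centralizer_mod N (carrier G)" using insert by blast
  have sub: "insert x N \<subseteq> ?N" by (rule generate_superset)
  obtain k where "x [^] (p ^ k) \<in> N" using insert by blast
  then show ?case
  proof (rule invariants_polynomial_prime_power_step[OF p insert.prems(1) x])
    show "invariants_polynomial p ?N"
    proof (rule insert.IH)
      show "?N \<lhd> G" using central_extension_normal(1)[OF insert.prems(1), of "{x}"] x by simp
      show "X \<subseteq> centralizer_mod ?N (carrier G)"
        using insert.prems(2) centralizer_mod_mono[of N ?N] sub by blast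
      show "\<forall>x \<in> X. \<exists>k. x [^] (p ^ k) \<in> ?N" using insert.prems(3) sub by blast
      have "insert x X \<union> N \<subseteq> X \<union> ?N" using sub by blast
      then show "invariants_polynomial p (generate G (X \<union> ?N))"
        using insert.prems(4) invariants_polynomial_mono mono_generate by meson
    qed
  qed
qed

text \<open>The property is carried down the lower central series from \<open>G\<close> to
  \<open>N\<close>. Each factor is central and generated by finitely many
  \<open>p\<close>-elements.\<close>

lemma invariants_polynomial_torsion:
  assumes p: "prime p" and N: "N \<lhd> G"
    and S: "finite S" "S \<subseteq> carrier G" "generate G S = carrier G"
    and T: "\<And>x. x \<in> carrier G \<Longrightarrow> \<exists>k. x [^] (p ^ k) \<in> N"
    and c: "upper_central_mod N c = carrier G"
  shows "invariants_polynomial p N"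
proof -
  let ?A = "lower_central_mod N"
  have A: "?A i \<lhd> G" "N \<subseteq> ?A i" for i using lower_central_mod_normal[OF N] by blast+
  have sub: "?A i \<subseteq> carrier G" for i using A normal_imp_subgroup subgroup.subset by blast
  have "invariants_polynomial p (?A i)" for i
  proof (induction i)
    case 0
    \<comment> \<open>Functions invariant under all of \<open>G\<close> are constant modulo
      \<open>p\<close>, so they have degree less than 1.\<close>
    have "polynomial_mod p (Suc 0) v" if "right_invariant_mod p (carrier G) v" for v
      using that by (simp add: right_invariant_mod_def)
    then show ?case unfolding invariants_polynomial_def lower_central_mod.simps by blast
  next
    case (Suc i)
    obtain X where X: "finite X" "X \<subseteq> ?A i" "?A i \<subseteq> generate G (X \<union> ?A (Suc i))"
      using lower_central_mod_finitely_generated[OF N S] by blast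
    show ?case
    proof (rule invariants_polynomial_finite_step[OF p X(1) A(1)])
      have "commutator a y \<in> ?A (Suc i)" if "a \<in> ?A i" "y \<in> carrier G" for a y
        using that by (auto intro: generate.incl)
      then show "X \<subseteq> centralizer_mod (?A (Suc i)) (carrier G)"
        using X(2) sub[of i] by (auto simp: centralizer_mod_def simp del: lower_central_mod.simps)
      show "\<forall>x \<in> X. \<exists>k. x [^] (p ^ k) \<in> ?A (Suc i)"
        using T X(2) sub A(2) by blast
      show "invariants_polynomial p (generate G (X \<union> ?A (Suc i)))"
        using Suc X(3) by (rule invariants_polynomial_mono)
    qed
  qed
  moreover have "?A c \<subseteq> N" using lower_central_mod_subset_upper[OF N c, of c] by simp
  ultimately show ?thesis using invariants_polynomial_mono by blast
qed

end

section \<open>Subgroups maximal with respect to omitting an element\<close>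

context group
begin

section \<open>Normal cores and Zorn's lemma\<close>

definition core :: "'a set \<Rightarrow> 'a set" where
  "core M = {x \<in> carrier G. \<forall>y \<in> carrier G. y \<otimes> x \<otimes> inv y \<in> M}"

lemma core_subset: "core M \<subseteq> M"
proof
  fix x assume "x \<in> core M"
  then have "x \<in> carrier G" "\<one> \<otimes> x \<otimes> inv \<one> \<in> M" unfolding core_def by blast+
  then show "x \<in> M" by simp
qed

lemma core_normal:
  assumes "subgroup M G"
  shows "core M \<lhd> G"
proof -
  interpret M: subgroup M G by fact
  have "subgroup (core M) G"
  proof (rule subgroupI)
    have "\<one> \<in> core M" by (simp add: core_def)
    then show "core M \<noteq> {}" by blast
  next
    fix a b assume a: "a \<in> core M"
    have "y \<otimes> inv a \<otimes> inv y \<in> M" if "y \<in> carrier G" for y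
    proof -
      have "inv (y \<otimes> a \<otimes> inv y) \<in> M" using a that by (auto simp: core_def)
      then show ?thesis using a that by (simp add: core_def group_normalize)
    qed
    then show "inv a \<in> core M" using a by (simp add: core_def)
    assume b: "b \<in> core M"
    have "y \<otimes> (a \<otimes> b) \<otimes> inv y \<in> M" if "y \<in> carrier G" for y
    proof -
      have "(y \<otimes> a \<otimes> inv y) \<otimes> (y \<otimes> b \<otimes> inv y) \<in> M" using a b that by (auto simp: core_def)
      then show ?thesis using a b that by (simp add: core_def group_normalize)
    qed
    then show "a \<otimes> b \<in> core M" using a b by (simp add: core_def)
  qed (auto simp: core_def)
  moreover have "x \<otimes> h \<otimes> inv x \<in> core M" if "x \<in> carrier G" "h \<in> core M" for x h
  proof -
    have "(y \<otimes> x) \<otimes> h \<otimes> inv (y \<otimes> x) \<in> M" if "y \<in> carrier G" for y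
      using that \<open>x \<in> carrier G\<close> \<open>h \<in> core M\<close> by (auto simp: core_def)
    then show ?thesis using that by (simp add: core_def group_normalize)
  qed
  ultimately show ?thesis by (simp add: normal_inv_iff)
qed

lemma exists_subgroup_maximal_omitting:
  assumes H: "subgroup H G" and g: "g \<notin> H"
  obtains M where "subgroup M G" "H \<subseteq> M" "g \<notin> M"
    "\<And>U. subgroup U G \<Longrightarrow> M \<subset> U \<Longrightarrow> g \<in> U"
proof -
  let ?A = "{U. subgroup U G \<and> H \<subseteq> U \<and> g \<notin> U}"
  have "\<exists>M \<in> ?A. \<forall>X \<in> ?A. M \<subseteq> X \<longrightarrow> X = M"
  proof (rule subset_Zorn_nonempty)
    show "?A \<noteq> {}" using H g by blast
    fix C assume C0: "C \<noteq> {}" and C: "subset.chain ?A C"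
    then have CA: "\<And>U. U \<in> C \<Longrightarrow> subgroup U G \<and> H \<subseteq> U \<and> g \<notin> U"
      and tot: "\<And>U V. U \<in> C \<Longrightarrow> V \<in> C \<Longrightarrow> U \<subseteq> V \<or> V \<subseteq> U"
      unfolding subset_chain_def by blast+
    have "subgroup (\<Union>C) G"
    proof (rule subgroupI)
      show "\<Union>C \<subseteq> carrier G" using CA subgroup.subset by blast
      show "\<Union>C \<noteq> {}" using C0 CA subgroup.one_closed by blast
      show "inv a \<in> \<Union>C" if "a \<in> \<Union>C" for a
        using that CA by (meson UnionE UnionI subgroup.m_inv_closed)
      show "a \<otimes> b \<in> \<Union>C" if "a \<in> \<Union>C" "b \<in> \<Union>C" for a b
      proof -
        obtain U V where UV: "U \<in> C" "V \<in> C" "a \<in> U" "b \<in> V" using \<open>a \<in> \<Union>C\<close> \<open>b \<in> \<Union>C\<close> by blast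
        then obtain W where "W \<in> C" "a \<in> W" "b \<in> W" using tot[of U V] by blast
        then show ?thesis using CA by (meson UnionI subgroup.m_closed)
      qed
    qed
    moreover have "H \<subseteq> \<Union>C" using C0 CA by blast
    moreover have "g \<notin> \<Union>C" using CA by blast
    ultimately show "\<Union>C \<in> ?A" by simp
  qed
  then obtain M where M: "M \<in> ?A" "\<forall>X \<in> ?A. M \<subseteq> X \<longrightarrow> X = M" by (rule bexE)
  show ?thesis
  proof (rule that[of M])
    show "g \<in> U" if "subgroup U G" "M \<subset> U" for U
      using M(1) M(2)[rule_format, of U] that by auto
  qed (use M(1) in auto)
qed

text \<open>Every nontrivial element of \<open>Z\<close> has \<open>b\<close> as a power. This makes
  the order of \<open>b\<close> finite, and any prime divisor \<open>p\<close> of it works: a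
  nontrivial element of order prime to \<open>p\<close> would have \<open>b\<close> as a power,
  contradicting the choice of \<open>p\<close>.\<close>

lemma cyclic_meets_prime_power_torsion:
  assumes b: "b \<in> carrier G" "b \<noteq> \<one>"
    and Z: "subgroup Z G" "b \<in> Z"
    and meets: "\<And>a. a \<in> Z \<Longrightarrow> a \<noteq> \<one> \<Longrightarrow> \<exists>j::int. a [^] j = b"
  shows "\<exists>p. prime p \<and> (\<forall>a \<in> Z. \<exists>k. a [^] (p ^ k :: nat) = \<one>)"
proof -
  interpret Z: subgroup Z G by fact
  have powZ: "a [^] (n::nat) \<in> Z" if "a \<in> Z" for a n
    using subgroup_int_pow_closed[OF Z(1) that, of "int n"] by (simp only: int_pow_int)
  have fin: "ord b \<noteq> 0"
  proof (cases "b [^] (2::nat) = \<one>")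
    case True
    then have "ord b dvd 2" using b pow_eq_id by blast
    then show ?thesis by (metis dvd_0_left_iff zero_neq_numeral)
  next
    \<comment> \<open>If the square of \<open>b\<close> is nontrivial, then \<open>b\<close> is a
      power of it, so the order of \<open>b\<close> divides an odd number.\<close>
    case False
    then obtain j :: int where j: "(b [^] (2::nat)) [^] j = b" using meets powZ Z(2) by blast
    have "b [^] (2 * j) = (b [^] (2::int)) [^] j"
      using b by (simp add: int_pow_pow)
    also have "b [^] (2::int) = b [^] (2::nat)"
      using int_pow_int[of G b 2] by simp
    finally have "b [^] (2 * j) = b" using j by simp
    then have "b [^] (2 * j - 1) = \<one>" using b by (simp add: int_pow_diff)
    then have "int (ord b) dvd 2 * j - 1" using b int_pow_eq_id by blast
    moreover have "2 * j - 1 \<noteq> 0" by presburger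
    ultimately show ?thesis by (metis dvd_0_left_iff of_nat_0)
  qed
  have ne1: "ord b \<noteq> 1" using b ord_eq_1 by blast
  then obtain p where p: "prime p" "p dvd ord b" using prime_factor_nat by blast
  have key: "\<not> ord a dvd m" if a: "a \<in> Z" "\<not> p dvd m" "a \<noteq> \<one>" for a m
  proof
    assume "ord a dvd m"
    obtain j :: int where j: "a [^] j = b" using meets[OF a(1,3)] by blast
    have "a [^] m = \<one>" using \<open>ord a dvd m\<close> a(1) pow_eq_id[of a m] by simp
    then have "b [^] int m = \<one>"
      using j a(1) by (metis Z.mem_carrier int_pow_int int_pow_one int_pow_pow mult.commute)
    then have "ord b dvd m" using b pow_eq_id by (simp add: int_pow_int)
    then show False using p(2) a(2) dvd_trans by blast
  qed
  have "\<exists>k. a [^] (p ^ k) = \<one>" if a: "a \<in> Z" for a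
  proof (cases "a = \<one>")
    case False
    have ac: "a \<in> carrier G" using a by simp
    obtain j :: int where j: "a [^] j = b" using meets a False by blast
    have j0: "j \<noteq> 0" using j b by auto
    have "b [^] int (ord b) = \<one>" using b by (simp add: int_pow_int)
    then have "a [^] (j * int (ord b)) = \<one>" using j ac by (metis int_pow_pow)
    then have "int (ord a) dvd j * int (ord b)" using ac int_pow_eq_id by blast
    then have "ord a \<noteq> 0" using j0 fin
      by (metis dvd_0_left_iff mult_eq_0_iff of_nat_0 of_nat_eq_0_iff)
    moreover have "\<not> is_unit p" using p(1) by auto
    ultimately obtain m where m: "ord a = p ^ multiplicity p (ord a) * m" "\<not> p dvd m"
      using multiplicity_decompose'[of "ord a" p] by metis
    \<comment> \<open>Raising \<open>a\<close> to the \<open>p\<close>-part of its order leaves an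
      element of order prime to \<open>p\<close>, which \<open>key\<close> forces to be
      trivial.\<close>
    let ?k = "multiplicity p (ord a)"
    have "(a [^] (p ^ ?k)) [^] m = \<one>" using ac m(1) by (metis nat_pow_pow pow_ord_eq_1)
    then have "ord (a [^] (p ^ ?k)) dvd m" using ac pow_eq_id by simp
    then have "a [^] (p ^ ?k) = \<one>" using key[OF powZ[OF a] m(2)] by blast
    then show ?thesis by blast
  qed auto
  then show ?thesis using p(1) by blast
qed

text \<open>Since \<open>z\<close> is central modulo a subgroup of \<open>M\<close>, the product of
  the powers of \<open>z\<close> with \<open>M\<close> is a subgroup. It properly contains
  \<open>M\<close>, so by maximality it contains \<open>g\<close>.\<close>

lemma maximal_omitting_meets_centralizer:
  assumes M: "subgroup M G" "g \<notin> M" "g \<in> carrier G"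
    and max: "\<And>U. subgroup U G \<Longrightarrow> M \<subset> U \<Longrightarrow> g \<in> U"
    and z: "z \<in> centralizer_mod (core M) (carrier G)" "z \<notin> M"
  shows "\<exists>i::int. z [^] i \<otimes> g \<in> M"
proof -
  interpret M: subgroup M G by fact
  let ?N = "core M"
  let ?Z = "centralizer_mod ?N (carrier G)"
  have N: "?N \<lhd> G" using core_normal M by blast
  have NM: "?N \<subseteq> M" by (rule core_subset)
  have zc: "z \<in> carrier G" using z by (simp add: centralizer_mod_def)
  have zi: "commutator (z [^] (i::int)) m \<in> M" if "m \<in> carrier G" for i m
    using subgroup_int_pow_closed[OF subgroup_centralizer_mod[OF N subset_refl] z(1), of i] that NM
    by (auto simp: centralizer_mod_def)
  let ?U = "{u \<in> carrier G. \<exists>i::int. z [^] i \<otimes> u \<in> M}"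
  have "subgroup ?U G"
  proof (rule subgroupI)
    have "z [^] (0::int) \<otimes> \<one> \<in> M" by simp
    then show "?U \<noteq> {}" by blast
  next
    fix u assume "u \<in> ?U"
    then obtain i :: int where u: "u \<in> carrier G" "z [^] i \<otimes> u \<in> M" by blast
    let ?m = "z [^] i \<otimes> u"
    have "z [^] (- i) \<otimes> inv u = commutator (z [^] (- i)) (inv ?m) \<otimes> inv ?m"
      using u(1) zc by (simp add: commutator_def int_pow_neg group_normalize)
    also have "\<dots> \<in> M" using zi[of "inv ?m" "- i"] u zc by blast
    finally show "inv u \<in> ?U" using u(1) by blast
  next
    fix u w assume "u \<in> ?U" "w \<in> ?U"
    then obtain i j :: int where u: "u \<in> carrier G" "z [^] i \<otimes> u \<in> M"
      and w: "w \<in> carrier G" "z [^] j \<otimes> w \<in> M" by blast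
    let ?m = "z [^] i \<otimes> u"
    have "z [^] (j + i) \<otimes> (u \<otimes> w) = commutator (z [^] j) ?m \<otimes> (?m \<otimes> (z [^] j \<otimes> w))"
      using u(1) w(1) zc by (simp add: commutator_def int_pow_mult group_normalize)
    also have "\<dots> \<in> M" using zi[of ?m j] u w zc by blast
    finally show "u \<otimes> w \<in> ?U" using u(1) w(1) by blast
  qed auto
  moreover have "M \<subset> ?U"
  proof -
    have "z [^] (0::int) \<otimes> u \<in> M" if "u \<in> M" for u using that by simp
    then have "M \<subseteq> ?U" using M.subset by blast
    moreover have "z [^] (- 1 :: int) \<otimes> z \<in> M" using zc by (simp add: int_pow_neg)
    then have "z \<in> ?U" using zc by blast
    ultimately show ?thesis using z(2) by blast
  qed
  ultimately have "g \<in> ?U" by (rule max)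
  then show ?thesis by blast
qed

text \<open>Modulo the core, the centre meets \<open>M\<close> trivially. Every nontrivial central
  element has a power that agrees with \<open>g\<close> up to a factor in \<open>M\<close>, and two
  such powers agree modulo the core; the common value is the image of \<open>b\<close>.\<close>

lemma maximal_omitting_prime_power_torsion:
  assumes M: "subgroup M G" "g \<notin> M" "g \<in> carrier G"
    and max: "\<And>U. subgroup U G \<Longrightarrow> M \<subset> U \<Longrightarrow> g \<in> U"
    and c: "upper_central_mod (core M) c = carrier G"
  shows "\<exists>p. prime p \<and>
    (\<forall>z \<in> centralizer_mod (core M) (carrier G). \<exists>k. z [^] (p ^ k :: nat) \<in> core M)"
proof -
  interpret M: subgroup M G by fact
  let ?N = "core M"
  let ?Z = "centralizer_mod ?N (carrier G)"
  have N: "?N \<lhd> G" using core_normal M by blast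
  interpret Q: group_hom G "G Mod ?N" "\<lambda>a. ?N #> a" by (rule group_hom_rcoset[OF N])
  have NM: "?N \<subseteq> M" by (rule core_subset)
  have sZ: "subgroup ?Z G" by (rule subgroup_centralizer_mod[OF N subset_refl])
  have ZM: "z \<in> ?N" if z: "z \<in> ?Z" "z \<in> M" for z
  proof -
    have "y \<otimes> z \<otimes> inv y \<in> M" if "y \<in> carrier G" for y
    proof -
      have "commutator z y \<in> M" using z that NM by (auto simp: centralizer_mod_def)
      then show ?thesis using z that by (simp add: conjugate_eq_commutator)
    qed
    then show ?thesis using z by (simp add: core_def)
  qed
  \<comment> \<open>With trivial centre the upper central series would stay at \<open>?N\<close> and
    never reach \<open>g\<close>.\<close>
  have "\<exists>z \<in> ?Z. z \<notin> ?N"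
  proof (rule ccontr)
    assume "\<not> ?thesis"
    then have "?Z = ?N" using subset_centralizer_mod[OF N] by blast
    then have "upper_central_mod ?N i = ?N" for i by (induction i) auto
    then show False using c M(2,3) NM by blast
  qed
  then obtain z where z: "z \<in> ?Z" "z \<notin> ?N" by blast
  then obtain i :: int where i: "z [^] i \<otimes> g \<in> M"
    using maximal_omitting_meets_centralizer[OF M max] ZM by blast
  define b where "b = z [^] (- i)"
  have zc: "z \<in> carrier G" using z by (simp add: centralizer_mod_def)
  have bZ: "b \<in> ?Z" unfolding b_def using subgroup_int_pow_closed[OF sZ z(1)] .
  have bc: "b \<in> carrier G" using bZ by (simp add: centralizer_mod_def)
  have bg: "inv b \<otimes> g \<in> M" using i zc by (simp add: b_def int_pow_neg)
  have bN: "b \<notin> ?N"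
  proof
    assume "b \<in> ?N"
    then have "b \<otimes> (inv b \<otimes> g) \<in> M" using bg NM by blast
    then show False using M(2,3) bc by (simp add: group_normalize)
  qed
  let ?f = "\<lambda>a. ?N #> a"
  have "\<exists>p. prime p \<and> (\<forall>a \<in> ?f ` ?Z. \<exists>k. a [^]\<^bsub>G Mod ?N\<^esub> (p ^ k :: nat) = \<one>\<^bsub>G Mod ?N\<^esub>)"
  proof (rule Q.H.cyclic_meets_prime_power_torsion)
    show "?f b \<in> carrier (G Mod ?N)" by (rule Q.hom_closed[OF bc])
    show "?f b \<noteq> \<one>\<^bsub>G Mod ?N\<^esub>" using rcoset_eq_one_iff[OF N bc] bN by simp
    show "subgroup (?f ` ?Z) (G Mod ?N)" using Q.subgroup_img_is_subgroup[OF sZ] .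
    show "?f b \<in> ?f ` ?Z" using bZ by blast
    show "\<exists>j::int. a [^]\<^bsub>G Mod ?N\<^esub> j = ?f b"
      if a: "a \<in> ?f ` ?Z" "a \<noteq> \<one>\<^bsub>G Mod ?N\<^esub>" for a
    proof -
      obtain y where y: "y \<in> ?Z" "a = ?f y" using a by blast
      have yc: "y \<in> carrier G" using y by (simp add: centralizer_mod_def)
      have "y \<notin> ?N" using a(2) y rcoset_eq_one_iff[OF N yc] by simp
      then obtain j :: int where j: "y [^] j \<otimes> g \<in> M"
        using maximal_omitting_meets_centralizer[OF M max] ZM y by blast
      \<comment> \<open>Dividing the two relations cancels \<open>g\<close>, leaving a central
        element of \<open>M\<close>, hence an element of the core.\<close>
      have "(y [^] j \<otimes> g) \<otimes> inv (inv b \<otimes> g) \<in> M" using j bg by blast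
      then have "y [^] j \<otimes> b \<in> M" using yc bc M(3) by (simp add: group_normalize)
      moreover have "y [^] j \<otimes> b \<in> ?Z"
        using bZ subgroup_int_pow_closed[OF sZ y(1)] sZ by (simp add: subgroup.m_closed)
      ultimately have "?f (y [^] j \<otimes> b) = \<one>\<^bsub>G Mod ?N\<^esub>"
        using ZM rcoset_eq_one_iff[OF N, of "y [^] j \<otimes> b"] yc bc by blast
      then have "?f (y [^] j) \<otimes>\<^bsub>G Mod ?N\<^esub> ?f b = \<one>\<^bsub>G Mod ?N\<^esub>"
        using Q.hom_mult[OF int_pow_closed[OF yc] bc] by simp
      then have "inv\<^bsub>G Mod ?N\<^esub> ?f (y [^] j) = ?f b"
        using Q.H.inv_equality Q.hom_closed yc bc Q.H.inv_comm int_pow_closed by meson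
      then have "a [^]\<^bsub>G Mod ?N\<^esub> (- j) = ?f b"
        using Q.hom_int_pow[OF yc] Q.hom_closed[OF yc] y(2) by (simp add: Q.H.int_pow_neg)
      then show ?thesis by blast
    qed
  qed
  then obtain p where p: "prime p"
    and tors: "\<And>z. z \<in> ?Z \<Longrightarrow> \<exists>k. ?f z [^]\<^bsub>G Mod ?N\<^esub> (p ^ k :: nat) = \<one>\<^bsub>G Mod ?N\<^esub>"
    by blast
  have "\<exists>k. z [^] (p ^ k :: nat) \<in> ?N" if "z \<in> ?Z" for z
  proof -
    have "z \<in> carrier G" using that by (simp add: centralizer_mod_def)
    then show ?thesis
      using tors[OF that] Q.hom_nat_pow rcoset_eq_one_iff[OF N] by (metis nat_pow_closed)
  qed
  then show ?thesis using p by blast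
qed

end

section \<open>The nilpotent semidirect product\<close>

context group
begin

text \<open>Picks one representative of each class of functions congruent modulo \<open>p\<close> on
  the carrier. The default 0 elsewhere makes the group laws hold as equations between HOL
  functions.\<close>

definition reduce_mod :: "nat \<Rightarrow> ('a \<Rightarrow> int) \<Rightarrow> 'a \<Rightarrow> int" where
  "reduce_mod p v = (\<lambda>y. if y \<in> carrier G then v y mod int p else 0)"

text \<open>
  The group acts by right translation on the functions of degree less than \<open>n\<close>, which are
  represented by their reduced representatives.
\<close>

definition polynomial_semidirect :: "nat \<Rightarrow> nat \<Rightarrow> (('a \<Rightarrow> int) \<times> 'a) monoid" where
  "polynomial_semidirect p n =
    \<lparr>carrier = {u. polynomial_mod p n u \<and> reduce_mod p u = u} \<times> carrier G,
     monoid.mult = (\<lambda>(u, x) (w, y). (reduce_mod p (\<lambda>z. u z + w (z \<otimes> x)), x \<otimes> y)),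
     one = (\<lambda>_. 0, \<one>)\<rparr>"

lemma reduce_mod_idem [simp]: "reduce_mod p (reduce_mod p u) = reduce_mod p u"
  by (simp add: reduce_mod_def fun_eq_iff)

lemma reduce_mod_zero [simp]: "reduce_mod p (\<lambda>_. 0) = (\<lambda>_. 0)"
  by (simp add: reduce_mod_def fun_eq_iff)

lemma reduce_mod_eqI:
  assumes "\<And>y. y \<in> carrier G \<Longrightarrow> u y mod int p = v y mod int p"
  shows "reduce_mod p u = reduce_mod p v"
  using assms by (simp add: reduce_mod_def fun_eq_iff)

lemma reduce_mod_apply [simp]: "y \<in> carrier G \<Longrightarrow> reduce_mod p u y = u y mod int p"
  by (simp add: reduce_mod_def)

lemma polynomial_mod_reduce [simp]: "polynomial_mod p n u \<Longrightarrow> polynomial_mod p n (reduce_mod p u)"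
  by (rule polynomial_mod_cong[of p u]) (auto simp: mod_eq_dvd_iff[symmetric])

lemma group_polynomial_semidirect: "group (polynomial_semidirect p n)"
proof (rule groupI)
  let ?K = "polynomial_semidirect p n"
  fix a b c
  assume a: "a \<in> carrier ?K"
  obtain u x where u: "a = (u, x)" "x \<in> carrier G" "polynomial_mod p n u" "reduce_mod p u = u"
    using a by (auto simp: polynomial_semidirect_def)
  show "\<one>\<^bsub>?K\<^esub> \<otimes>\<^bsub>?K\<^esub> a = a"
  proof -
    have "reduce_mod p (\<lambda>z. u (z \<otimes> \<one>)) = reduce_mod p u"
      by (rule reduce_mod_eqI) simp
    then show ?thesis using u by (simp add: polynomial_semidirect_def)
  qed
  let ?w = "\<lambda>z. - u (z \<otimes> inv x)"
  have "(reduce_mod p ?w, inv x) \<in> carrier ?K"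
    using u polynomial_mod_uminus[OF polynomial_mod_translate[of "inv x"]]
    by (auto simp: polynomial_semidirect_def)
  moreover have "reduce_mod p (\<lambda>z. reduce_mod p ?w z + u (z \<otimes> inv x)) = reduce_mod p (\<lambda>_. 0)"
    by (rule reduce_mod_eqI) (simp add: mod_simps)
  then have "(reduce_mod p ?w, inv x) \<otimes>\<^bsub>?K\<^esub> a = \<one>\<^bsub>?K\<^esub>"
    using u by (simp add: polynomial_semidirect_def)
  ultimately show "\<exists>y \<in> carrier ?K. y \<otimes>\<^bsub>?K\<^esub> a = \<one>\<^bsub>?K\<^esub>" by blast
  assume b: "b \<in> carrier ?K"
  obtain w y where w: "b = (w, y)" "y \<in> carrier G" "polynomial_mod p n w" "reduce_mod p w = w"
    using b by (auto simp: polynomial_semidirect_def)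
  show "a \<otimes>\<^bsub>?K\<^esub> b \<in> carrier ?K"
    using u w polynomial_mod_add[OF u(3) polynomial_mod_translate[OF u(2) w(3)]]
    by (auto simp: polynomial_semidirect_def)
  assume c: "c \<in> carrier ?K"
  obtain t s where t: "c = (t, s)" "s \<in> carrier G"
    using c by (auto simp: polynomial_semidirect_def)
  have "reduce_mod p (\<lambda>z. reduce_mod p (\<lambda>z. u z + w (z \<otimes> x)) z + t (z \<otimes> (x \<otimes> y)))
      = reduce_mod p (\<lambda>z. u z + reduce_mod p (\<lambda>z. w z + t (z \<otimes> y)) (z \<otimes> x))"
    using u w t by (intro reduce_mod_eqI) (simp add: mod_simps m_assoc add.assoc)
  then show "a \<otimes>\<^bsub>?K\<^esub> b \<otimes>\<^bsub>?K\<^esub> c = a \<otimes>\<^bsub>?K\<^esub> (b \<otimes>\<^bsub>?K\<^esub> c)"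
    using u w t by (simp add: polynomial_semidirect_def m_assoc)
next
  show "\<one>\<^bsub>polynomial_semidirect p n\<^esub> \<in> carrier (polynomial_semidirect p n)"
    by (simp add: polynomial_semidirect_def polynomial_mod_zero)
qed

text \<open>After \<open>c\<close> steps the lower central series projects trivially to
  \<open>G\<close>, so it consists of functions. Each further commutator lowers their degree bound
  by one, and after \<open>n\<close> more steps only the zero function is left.\<close>

lemma nilpotent_polynomial_semidirect:
  assumes nil: "nilpotent_group G"
  shows "nilpotent_group (polynomial_semidirect p n)"
proof -
  let ?K = "polynomial_semidirect p n"
  interpret K: group ?K by (rule group_polynomial_semidirect)
  obtain c where c: "lower_central G c = {\<one>}" using nil by (auto simp: nilpotent_group_def)
  have snd: "snd \<in> hom ?K G"
    by (auto simp: hom_def polynomial_semidirect_def)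
  let ?F = "\<lambda>j. {a \<in> carrier ?K. snd a = \<one> \<and> polynomial_mod p j (fst a)}"
  have mult1: "(u, \<one>) \<otimes>\<^bsub>?K\<^esub> (w, y) = (reduce_mod p (\<lambda>z. u z + w z), y)" if "y \<in> carrier G" for u w y
  proof -
    have "reduce_mod p (\<lambda>z. u z + w (z \<otimes> \<one>)) = reduce_mod p (\<lambda>z. u z + w z)"
      by (rule reduce_mod_eqI) simp
    then show ?thesis using that by (simp add: polynomial_semidirect_def)
  qed
  have F: "subgroup (?F j) ?K" for j
  proof (rule K.subgroupI)
    have "\<one>\<^bsub>?K\<^esub> \<in> ?F j"
      using K.one_closed by (simp add: polynomial_semidirect_def polynomial_mod_zero)
    then show "?F j \<noteq> {}" by blast
  next
    fix a assume a: "a \<in> ?F j"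
    then obtain u where u: "a = (u, \<one>)" "polynomial_mod p n u" "polynomial_mod p j u"
      by (cases a) (auto simp: polynomial_semidirect_def)
    let ?w = "reduce_mod p (\<lambda>z. - u z)"
    have "reduce_mod p (\<lambda>z. ?w z + u z) = reduce_mod p (\<lambda>_. 0)"
      by (rule reduce_mod_eqI) (simp add: mod_simps)
    then have "(?w, \<one>) \<otimes>\<^bsub>?K\<^esub> a = \<one>\<^bsub>?K\<^esub>"
      using u mult1[of \<one>] by (simp add: polynomial_semidirect_def)
    moreover have "(?w, \<one>) \<in> carrier ?K"
      using u polynomial_mod_uminus by (auto simp: polynomial_semidirect_def)
    ultimately have "inv\<^bsub>?K\<^esub> a = (?w, \<one>)" using a by (intro K.inv_equality) auto
    then show "inv\<^bsub>?K\<^esub> a \<in> ?F j"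
      using \<open>(?w, \<one>) \<in> carrier ?K\<close> u polynomial_mod_uminus by auto
  next
    fix a b assume a: "a \<in> ?F j" and b: "b \<in> ?F j"
    obtain u w where "a = (u, \<one>)" "b = (w, \<one>)" "polynomial_mod p j u" "polynomial_mod p j w"
      using a b by (cases a, cases b) auto
    then show "a \<otimes>\<^bsub>?K\<^esub> b \<in> ?F j"
      using K.m_closed[of a b] a b mult1[of \<one> u w] polynomial_mod_add by auto
  qed auto
  have comm: "a \<otimes>\<^bsub>?K\<^esub> b \<otimes>\<^bsub>?K\<^esub> inv\<^bsub>?K\<^esub> a \<otimes>\<^bsub>?K\<^esub> inv\<^bsub>?K\<^esub> b \<in> ?F j"
    if a: "a \<in> ?F (Suc j)" and b: "b \<in> carrier ?K" for a b j
  proof -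
    obtain u where u: "a = (u, \<one>)" "polynomial_mod p n u" "polynomial_mod p (Suc j) u"
      using a by (cases a) (auto simp: polynomial_semidirect_def)
    obtain w y where w: "b = (w, y)" "y \<in> carrier G"
      using b by (auto simp: polynomial_semidirect_def)
    \<comment> \<open>The function component of the commutator of \<open>a\<close> and
      \<open>b\<close>: it does not involve \<open>w\<close>, and as a difference it has smaller
      degree than \<open>u\<close>.\<close>
    let ?q = "reduce_mod p (\<lambda>z. - difference y u z)"
    let ?t = "(?q, \<one>)"
    have "polynomial_mod p n (\<lambda>z. - difference y u z)"
      using polynomial_mod_uminus[OF polynomial_mod_diff[OF polynomial_mod_translate[OF w(2) u(2)] u(2)]] .
    then have tK: "?t \<in> carrier ?K"
      using polynomial_mod_reduce by (simp add: polynomial_semidirect_def)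
    have "polynomial_mod p j (\<lambda>z. - difference y u z)"
      using u(3) w(2) polynomial_mod_uminus[of p j "difference y u"] by simp
    then have t: "?t \<in> ?F j" using tK polynomial_mod_reduce by simp
    have ba: "b \<otimes>\<^bsub>?K\<^esub> a = (reduce_mod p (\<lambda>z. w z + u (z \<otimes> y)), y)"
      using u w by (simp add: polynomial_semidirect_def)
    have "reduce_mod p (\<lambda>z. ?q z + reduce_mod p (\<lambda>z. w z + u (z \<otimes> y)) z)
        = reduce_mod p (\<lambda>z. u z + w z)"
      by (rule reduce_mod_eqI) (simp add: mod_simps)
    then have "?t \<otimes>\<^bsub>?K\<^esub> (b \<otimes>\<^bsub>?K\<^esub> a) = a \<otimes>\<^bsub>?K\<^esub> b"
      using ba mult1 u w by simp
    moreover have "a \<in> carrier ?K" using a by simp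
    ultimately have "a \<otimes>\<^bsub>?K\<^esub> b \<otimes>\<^bsub>?K\<^esub> inv\<^bsub>?K\<^esub> a \<otimes>\<^bsub>?K\<^esub> inv\<^bsub>?K\<^esub> b
        = ?t \<otimes>\<^bsub>?K\<^esub> (b \<otimes>\<^bsub>?K\<^esub> a) \<otimes>\<^bsub>?K\<^esub> inv\<^bsub>?K\<^esub> a \<otimes>\<^bsub>?K\<^esub> inv\<^bsub>?K\<^esub> b" by simp
    also have "\<dots> = ?t"
      using tK b \<open>a \<in> carrier ?K\<close> by (simp add: K.group_normalize)
    finally show ?thesis using t by simp
  qed
  have "lower_central ?K (c + i) \<subseteq> ?F (n - i)" if "i \<le> n" for i
    using that
  proof (induction i)
    case 0
    have "snd ` lower_central ?K c \<subseteq> {\<one>}"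
      using hom_lower_central[OF K.is_group is_group snd, of c] c by simp
    then show ?case
      using lower_central_in_carrier[OF K.is_group, of c] by (auto simp: polynomial_semidirect_def)
  next
    case (Suc i)
    then have "lower_central ?K (c + i) \<subseteq> ?F (Suc (n - Suc i))"
      by (simp add: Suc_diff_Suc del: polynomial_mod.simps)
    then show ?case
      unfolding add_Suc_right lower_central.simps commutator_subgroup_def
      using comm by (intro K.generate_subgroup_incl[OF _ F]) blast
  qed
  from this[of n] have "lower_central ?K (c + n) \<subseteq> ?F 0" by simp
  moreover have "?F 0 \<subseteq> {\<one>\<^bsub>?K\<^esub>}"
  proof clarify
    fix u x assume a: "(u, x) \<in> carrier ?K" "snd (u, x) = \<one>" "polynomial_mod p 0 (fst (u, x))"
    then have "reduce_mod p u = reduce_mod p (\<lambda>_. 0)" by (intro reduce_mod_eqI) simp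
    then show "(u, x) = \<one>\<^bsub>?K\<^esub>" using a by (simp add: polynomial_semidirect_def)
  qed
  ultimately have "lower_central ?K (c + n) = {\<one>\<^bsub>?K\<^esub>}"
    using one_in_lower_central[OF K.is_group, of "c + n"] by blast
  then show ?thesis using K.is_group by (auto simp: nilpotent_group_def)
qed

text \<open>
  The second homomorphism is the first one conjugated by \<open>v\<close>, so the two agree exactly on the
  stabilizer of \<open>v\<close> under right translation.
\<close>

lemma polynomial_separates_dominion:
  assumes nil: "nilpotent_group G" and v: "polynomial_mod p n v"
    and H: "\<And>z h. z \<in> carrier G \<Longrightarrow> h \<in> H \<Longrightarrow> v (z \<otimes> h) = v z"
    and g: "g \<in> nil_dominion G H"
  shows "int p dvd v g - v \<one>"
proof -
  let ?K = "polynomial_semidirect p n"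
  let ?d = "\<lambda>x. reduce_mod p (difference x v)"
  define f1 :: "'a \<Rightarrow> ('a \<Rightarrow> int) \<times> 'a" where "f1 = (\<lambda>x. (\<lambda>_. 0, x))"
  define f2 where "f2 = (\<lambda>x. (?d x, x))"
  have "f1 \<in> hom G ?K"
    by (auto simp: f1_def hom_def polynomial_semidirect_def polynomial_mod_zero)
  moreover have "f2 \<in> hom G ?K"
  proof -
    \<comment> \<open>The cocycle identity for differences is exactly multiplicativity of
      \<open>f2\<close>.\<close>
    have "?d (x \<otimes> y) = reduce_mod p (\<lambda>z. ?d x z + ?d y (z \<otimes> x))"
      if "x \<in> carrier G" "y \<in> carrier G" for x y
      using that by (intro reduce_mod_eqI) (simp add: mod_simps m_assoc)
    moreover have "polynomial_mod p n (?d x)" if "x \<in> carrier G" for x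
      using polynomial_mod_diff[OF polynomial_mod_translate[OF that v] v] by simp
    ultimately show ?thesis by (auto simp: f2_def hom_def polynomial_semidirect_def)
  qed
  moreover have "\<forall>h \<in> H. f1 h = f2 h"
  proof
    fix h assume "h \<in> H"
    then have "?d h = reduce_mod p (\<lambda>_. 0)" using H by (intro reduce_mod_eqI) simp
    then show "f1 h = f2 h" by (simp add: f1_def f2_def)
  qed
  ultimately have "f1 g = f2 g"
    by (rule nil_dominion_any_universe[OF is_group g nilpotent_polynomial_semidirect[OF nil]])
  \<comment> \<open>The function components of \<open>f1 g\<close> and \<open>f2 g\<close> are
    compared at the identity.\<close>
  then have "?d g \<one> = 0" by (simp add: f1_def f2_def fun_eq_iff)
  moreover have "g \<in> carrier G" using g by (simp add: nil_dominion_def dominion_def)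
  ultimately show ?thesis by (simp add: mod_eq_0_iff_dvd)
qed

end

theorem theorem3p11:
  fixes G :: "('a, 'b) monoid_scheme" and H :: "'a set"
  assumes "nilpotent_group G"
    and "finitely_generated_group G"
    and "subgroup H G"
  shows "nil_dominion G H = H"
proof
  interpret group G using assms(1) by (simp add: nilpotent_group_def)
  show "H \<subseteq> nil_dominion G H"
    using subgroup.subset[OF assms(3)] by (auto simp: nil_dominion_def dominion_def)
  obtain c where c: "lower_central G c = {\<one>\<^bsub>G\<^esub>}"
    using assms(1) by (auto simp: nilpotent_group_def)
  obtain S where S: "finite S" "S \<subseteq> carrier G" "generate G S = carrier G"
    using assms(2) by (auto simp: finitely_generated_group_def)
  show "nil_dominion G H \<subseteq> H"
  proof (rule subsetI, rule ccontr)
    fix g assume g: "g \<in> nil_dominion G H" and gH: "g \<notin> H"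
    have gc: "g \<in> carrier G" using g by (simp add: nil_dominion_def dominion_def)
    obtain M where M: "subgroup M G" "H \<subseteq> M" "g \<notin> M"
      and max: "\<And>U. subgroup U G \<Longrightarrow> M \<subset> U \<Longrightarrow> g \<in> U"
      using exists_subgroup_maximal_omitting[OF assms(3) gH] by metis
    interpret M: subgroup M G by fact
    let ?N = "core M"
    have N: "?N \<lhd> G" by (rule core_normal[OF M(1)])
    have Zc: "upper_central_mod ?N c = carrier G" by (rule upper_central_mod_eq_carrier[OF N c])
    obtain p where p: "prime p"
      and T: "\<And>z. z \<in> centralizer_mod ?N (carrier G) \<Longrightarrow> \<exists>k. z [^]\<^bsub>G\<^esub> (p ^ k :: nat) \<in> ?N"
      using maximal_omitting_prime_power_torsion[OF M(1,3) gc max Zc] by blast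
    have "invariants_polynomial p ?N"
      by (rule invariants_polynomial_torsion[OF p N S prime_power_torsion_mod[OF N S T Zc] Zc])
    then obtain n where n: "\<And>v. right_invariant_mod p ?N v \<Longrightarrow> polynomial_mod p n v"
      by (auto simp: invariants_polynomial_def)
    \<comment> \<open>The indicator function of \<open>M\<close> is invariant under
      \<open>M\<close>, hence under both \<open>H\<close> and the core, but it separates
      \<open>g\<close> from the identity.\<close>
    define v :: "'a \<Rightarrow> int" where "v = (\<lambda>y. if y \<in> M then 1 else 0)"
    have inv: "v (y \<otimes>\<^bsub>G\<^esub> a) = v y" if y: "y \<in> carrier G" and a: "a \<in> M" for y a
    proof -
      have "y \<in> M" if "y \<otimes>\<^bsub>G\<^esub> a \<in> M"
      proof -
        have "y \<otimes>\<^bsub>G\<^esub> a \<otimes>\<^bsub>G\<^esub> inv\<^bsub>G\<^esub> a \<in> M" using that a by blast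
        then show ?thesis using y a by (simp add: m_assoc)
      qed
      then show ?thesis using a by (auto simp: v_def)
    qed
    have "right_invariant_mod p ?N v"
      using inv core_subset[of M] by (auto simp: right_invariant_mod_def)
    then have "polynomial_mod p n v" by (rule n)
    then have "int p dvd v g - v \<one>\<^bsub>G\<^esub>"
      using inv M(2) g by (intro polynomial_separates_dominion[OF assms(1)]) auto
    then have "int p dvd 1" using M(3) by (simp add: v_def)
    then show False using p by (simp add: prime_nat_iff)
  qed
qed

end
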